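(* Let $r\ge 0$ be an integer, let $m_1,\dots,m_r$ be positive integers and put $m:=m_1+\cdots+m_r$. Let $a,b,c,d,e,f_1,\dots,f_r$ be complex numbers and put $s:=c+e-a-b-d-m$. Assume that none of $c$, $e$, $s+d$, $f_1,\dots,f_r$ is a non-positive integer, and that $$(c-a-m)_m\neq 0,\qquad (c-b-m)_m\neq 0,\qquad \Re(e-d)>0,\qquad \Re(s)>0 .$$ Let $(\eta_m)=(\eta_1,\dots,\eta_m)$ be the (nonvanishing) zeros, counted with multiplicity, of the parametric polynomial $\hat Q_m(t)$ associated with $a,b,c,(f_r),(m_r)$ (defined in the context). Then $$ {}_{r+3}F_{r+2}\left[\begin{array}{c} a,\,b,\,d,\,f_1+m_1,\dots,f_r+m_r\\ c,\,e,\,f_1,\dots,f_r\end{array};1\right] =\frac{\Gamma(e)\,\Gamma(s)}{\Gamma(e-d)\,\Gamma(s+d)}\; {}_{m+3}F_{m+2}\left[\begin{array}{c} c-a-m,\,c-b-m,\,d,\,\eta_1+1,\dots,\eta_m+1\\ c,\,s+d,\,\eta_1,\dots,\eta_m\end{array};1\right]. $$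
   Context: Pochhammer symbol: $(a)_0=1$, $(a)_n=a(a+1)\cdots(a+n-1)$ for $n\ge1$. The generalized hypergeometric series is $${}_pF_q\left[\begin{array}{c} a_1,\dots,a_p\\ b_1,\dots,b_q\end{array};x\right]=\sum_{k=0}^\infty\frac{(a_1)_k\cdots(a_p)_k}{(b_1)_k\cdots(b_q)_k}\frac{x^k}{k!}.$$ Coefficients $C_{k,r}$: let $\Lambda=(f_1)_{m_1}\cdots(f_r)_{m_r}$ (empty products equal $1$) and define $\sigma_0,\dots,\sigma_m$ by the polynomial identity $$(f_1+x)_{m_1}\cdots(f_r+x)_{m_r}=\sum_{j=0}^m\sigma_j x^j .$$ For $0\le k\le m$ put $$C_{k,r}=\frac1\Lambda\sum_{j=k}^m\sigma_j\,\mathbf S_j^{(k)},$$ where $\mathbf S_j^{(k)}$ are the Stirling numbers of the second kind (so $C_{0,r}=1$, $C_{m,r}=1/\Lambda$). Parametric polynomial: $$\hat Q_m(t)=\sum_{k=0}^m\frac{(-1)^k C_{k,r}\,(a)_k(b)_k(t)_k}{(c-a-m)_k(c-b-m)_k}\,G_{m,k}(t),\qquad G_{m,k}(t)={}_3F_2\left[\begin{array}{c}-m+k,\;t+k,\;c-a-b-m\\ c-a-m+k,\;c-b-m+k\end{array};1\right],$$ where the ${}_3F_2$ is the terminating sum over indices $0\le i\le m-k$. $G_{m,k}$ is a polynomial in $t$ of degree (at most) $m-k$, and $\hat Q_m(0)=1$, so the zeros of $\hat Q_m$ are nonzero and $\hat Q_m(t)=\prod_j(1-t/\eta_j)$. Convention: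 in the series containing the parameter pairs $\eta_j+1$ (numerator) and $\eta_j$ (denominator), the ratio $(\eta_j+1)_k/(\eta_j)_k$ means $1+k/\eta_j$, so that the product of these ratios over all the zeros equals $\hat Q_m(-k)$. (If $\hat Q_m$ happens to have degree less than $m$, the product is over its zeros, and still equals $\hat Q_m(-k)$.) *)

theory Defs
  imports
    "HOL-Analysis.Analysis"
    "HOL-Computational_Algebra.Computational_Algebra"
    "HOL-Combinatorics.Stirling"
begin

text \<open>
  The \<open>k\<close>-th term of the generalized hypergeometric series with numerator parameters \<open>as\<close>,
  denominator parameters \<open>bs\<close> and argument \<open>x\<close>.  In \<^const>\<open>fps_hypergeo\<close> the scaling
  parameter already contributes the factor \<open>x ^ k\<close>.
\<close>

definition hypergeom_term ::
    "complex list \<Rightarrow> complex list \<Rightarrow> complex \<Rightarrow> nat \<Rightarrow> complex" where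
  "hypergeom_term as bs x k = fps_nth (fps_hypergeo as bs x) k"

lemma hypergeom_term_altdef:
  "hypergeom_term as bs x k =
     (\<Prod>a\<leftarrow>as. pochhammer a k) / (\<Prod>b\<leftarrow>bs. pochhammer b k) * x ^ k / fact k"
proof -
  have "foldl (\<lambda>r a. r * pochhammer a k) z cs = z * (\<Prod>a\<leftarrow>cs. pochhammer a k)"
    for z :: complex and cs
    by (induction cs arbitrary: z) (simp_all add: mult.assoc)
  thus ?thesis
    by (simp add: hypergeom_term_def)
qed

text \<open>
  The \<open>k\<close>-th term of the series that in addition has the parameter pairs \<open>h + 1\<close> (numerator)
  and \<open>h\<close> (denominator) for each \<open>h\<close> in \<open>hs\<close>.  By convention the quotient
  \<open>pochhammer (h + 1) k / pochhammer h k\<close> stands for \<open>1 + k / h\<close>, so that it is also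
  meaningful if \<open>h\<close> is a negative integer.
\<close>

definition hypergeom_pairs_term ::
    "complex list \<Rightarrow> complex list \<Rightarrow> complex list \<Rightarrow> complex \<Rightarrow> nat \<Rightarrow> complex" where
  "hypergeom_pairs_term as bs hs x k =
     hypergeom_term as bs x k * (\<Prod>h\<leftarrow>hs. 1 + of_nat k / h)"

lemma pochhammer_pair_ratio:
  fixes h :: complex
  assumes "h \<notin> \<int>\<^sub>\<le>\<^sub>0"
  shows "pochhammer (h + 1) k / pochhammer h k = 1 + of_nat k / h"
proof -
  have "pochhammer h k \<noteq> 0" "h \<noteq> 0"
    using assms by (auto simp: pochhammer_eq_0_iff)
  moreover have "h * pochhammer (h + 1) k = pochhammer h k * (h + of_nat k)"
    using pochhammer_rec[of h k] by (simp add: pochhammer_Suc)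
  ultimately show ?thesis
    by (simp add: field_simps)
qed

lemma hypergeom_pairs_term_eq:
  assumes "\<forall>h\<in>set hs. h \<notin> \<int>\<^sub>\<le>\<^sub>0"
  shows "hypergeom_pairs_term as bs hs x k =
           hypergeom_term (as @ map (\<lambda>h. h + 1) hs) (bs @ hs) x k"
proof -
  have "(\<Prod>h\<leftarrow>hs. 1 + of_nat k / h) =
          (\<Prod>h\<leftarrow>hs. pochhammer (h + 1) k) / (\<Prod>h\<leftarrow>hs. pochhammer h k)"
    using assms by (induction hs) (simp_all add: pochhammer_pair_ratio[symmetric])
  thus ?thesis
    by (simp add: hypergeom_pairs_term_def hypergeom_term_altdef o_def mult_ac)
qed

text \<open>
  The parameters \<open>(f\<^sub>1, \<dots>, f\<^sub>r)\<close> and \<open>(m\<^sub>1, \<dots>, m\<^sub>r)\<close> are lists \<open>fs\<close>, \<open>ms\<close> of the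
  same length \<open>r\<close>, and \<open>m = sum_list ms\<close>.
\<close>

definition Lambda_prod :: "complex list \<Rightarrow> nat list \<Rightarrow> complex" where
  "Lambda_prod fs ms = (\<Prod>(f, n)\<leftarrow>zip fs ms. pochhammer f n)"

definition sigma_coeff :: "complex list \<Rightarrow> nat list \<Rightarrow> nat \<Rightarrow> complex" where
  "sigma_coeff fs ms j = coeff (\<Prod>(f, n)\<leftarrow>zip fs ms. pochhammer [:f, 1:] n) j"

definition C_coeff :: "complex list \<Rightarrow> nat list \<Rightarrow> nat \<Rightarrow> complex" where
  "C_coeff fs ms k =
     1 / Lambda_prod fs ms *
     (\<Sum>j=k..sum_list ms. sigma_coeff fs ms j * of_nat (Stirling j k))"

definition G_fun ::
    "nat \<Rightarrow> nat \<Rightarrow> complex \<Rightarrow> complex \<Rightarrow> complex \<Rightarrow> complex \<Rightarrow> complex" where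
  "G_fun m k a b c t =
     (\<Sum>i=0..m-k. hypergeom_term
        [- of_nat m + of_nat k, t + of_nat k, c - a - b - of_nat m]
        [c - a - of_nat m + of_nat k, c - b - of_nat m + of_nat k] 1 i)"

definition Qhat ::
    "complex \<Rightarrow> complex \<Rightarrow> complex \<Rightarrow> complex list \<Rightarrow> nat list \<Rightarrow> complex \<Rightarrow> complex" where
  "Qhat a b c fs ms t = (let m = sum_list ms in
     \<Sum>k=0..m. (-1) ^ k * C_coeff fs ms k * pochhammer a k * pochhammer b k * pochhammer t k /
        (pochhammer (c - a - of_nat m) k * pochhammer (c - b - of_nat m) k) * G_fun m k a b c t)"

text \<open>
  The same expressions as formal polynomials in the indeterminate \<open>[:0, 1:]\<close>, needed to speak
  about zeros with multiplicity; see \<open>poly_Qhat_poly\<close> and \<open>sigma_coeff_identity\<close> below.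
\<close>

definition G_poly :: "nat \<Rightarrow> nat \<Rightarrow> complex \<Rightarrow> complex \<Rightarrow> complex \<Rightarrow> complex poly" where
  "G_poly m k a b c =
     (\<Sum>i=0..m-k. smult (hypergeom_term
        [- of_nat m + of_nat k, c - a - b - of_nat m]
        [c - a - of_nat m + of_nat k, c - b - of_nat m + of_nat k] 1 i)
        (pochhammer [:of_nat k, 1:] i))"

definition Qhat_poly ::
    "complex \<Rightarrow> complex \<Rightarrow> complex \<Rightarrow> complex list \<Rightarrow> nat list \<Rightarrow> complex poly" where
  "Qhat_poly a b c fs ms = (let m = sum_list ms in
     \<Sum>k=0..m. smult ((-1) ^ k * C_coeff fs ms k * pochhammer a k * pochhammer b k /
        (pochhammer (c - a - of_nat m) k * pochhammer (c - b - of_nat m) k))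
        (pochhammer [:0, 1:] k * G_poly m k a b c))"

lemma poly_pochhammer: "poly (pochhammer p n) x = pochhammer (poly p x) n"
  for x :: complex
  by (induction n) (simp_all add: pochhammer_Suc)

lemma poly_G_poly: "poly (G_poly m k a b c) t = G_fun m k a b c t"
  by (simp add: G_poly_def G_fun_def poly_sum poly_pochhammer hypergeom_term_altdef
        add_ac mult_ac)

lemma poly_Qhat_poly: "poly (Qhat_poly a b c fs ms) t = Qhat a b c fs ms t"
  by (simp add: Qhat_poly_def Qhat_def Let_def poly_sum poly_pochhammer poly_G_poly mult_ac)

lemma degree_pochhammer_linear: "degree (pochhammer [:f, 1:] n) \<le> n" for f :: complex
proof (induction n)
  case (Suc n)
  have "degree (pochhammer [:f, 1:] (Suc n)) \<le>
          degree (pochhammer [:f, 1:] n) + degree ([:f, 1:] + of_nat n)"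
    unfolding pochhammer_Suc by (rule degree_mult_le)
  moreover have "degree ([:f, 1:] + of_nat n) \<le> 1"
    by (intro degree_add_le) simp_all
  ultimately show ?case
    using Suc by linarith
qed simp

lemma sigma_coeff_identity:
  assumes "length fs = length ms"
  shows "(\<Prod>(f, n)\<leftarrow>zip fs ms. pochhammer (f + x) n) =
           (\<Sum>j=0..sum_list ms. sigma_coeff fs ms j * x ^ j)"
proof -
  define P where "P = (\<Prod>(f, n)\<leftarrow>zip fs ms. pochhammer [:f, 1:] n)"
  have "degree P \<le> sum_list ms"
    using assms unfolding P_def
  proof (induction fs ms rule: list_induct2)
    case (Cons f fs n ms)
    show ?case
      using degree_mult_le[of "pochhammer [:f, 1:] n"
          "\<Prod>(f, n)\<leftarrow>zip fs ms. pochhammer [:f, 1:] n"]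
        degree_pochhammer_linear[of f n] Cons.IH by simp
  qed simp
  hence "poly P x = (\<Sum>j\<le>sum_list ms. coeff P j * x ^ j)"
    unfolding poly_altdef by (intro sum.mono_neutral_left) (auto simp: coeff_eq_0)
  moreover have "poly P x = (\<Prod>(f, n)\<leftarrow>zip fs ms. pochhammer (f + x) n)"
    using assms unfolding P_def
    by (induction fs ms rule: list_induct2) (simp_all add: poly_pochhammer)
  ultimately show ?thesis
    by (simp add: sigma_coeff_def P_def atLeast0AtMost)
qed

end

theory Submission
  imports Defs "HOL-Real_Asymp.Real_Asymp"
begin

text \<open>
  Write \<open>D = c - a - b - m\<close>. Expanding the product of the pairs \<open>(f + n)_k / (f)_k\<close> in falling
  factorials of \<open>k\<close> turns the generating function \<open>A\<close> of the left-hand coefficients (without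
  \<open>d\<close> and \<open>e\<close>) into a combination of shifted Gauss series. Euler's transformation, iterated with a
  contiguous relation, then shows that \<open>B = (1 - x)^(-D) A\<close> has the coefficients
  \<open>(c - a - m)_n (c - b - m)_n Qhat (-n) / ((c)_n n!)\<close>.

  Inserting \<open>A = (1 - x)^D B\<close> into the sum of \<open>A_n (d)_n / (e)_n\<close> and interchanging the order of
  summation leaves inner series that Gauss's theorem evaluates; no integral representation in \<open>d\<close>
  (and hence no analytic continuation) is needed. The double series converges absolutely if
  \<open>Re D \<le> 0\<close>, and the remaining case follows because the identity is symmetric under exchanging
  the two sides.
\<close>

subsection \<open>Formal power series identities\<close>

lemma nonpos_Ints_shift:
  fixes c :: "'a::field_char_0"
  assumes "c \<notin> \<int>\<^sub>\<le>\<^sub>0"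
  shows "c + of_nat n \<noteq> 0" "c \<noteq> 0" "c + of_nat n \<notin> \<int>\<^sub>\<le>\<^sub>0" "c + 1 \<notin> \<int>\<^sub>\<le>\<^sub>0" "pochhammer c n \<noteq> 0"
proof -
  have *: "c + of_nat k \<noteq> 0" for k
    using assms by (metis add_eq_0_iff2 minus_of_nat_in_nonpos_Ints)
  have **: "c + of_nat k \<notin> \<int>\<^sub>\<le>\<^sub>0" for k
  proof
    assume "c + of_nat k \<in> \<int>\<^sub>\<le>\<^sub>0"
    then obtain j where "c + of_nat k = - of_nat j"
      by (auto elim: nonpos_Ints_cases')
    hence "c + of_nat (k + j) = 0" by (simp add: add.assoc [symmetric])
    thus False using * by blast
  qed
  show "c + of_nat n \<noteq> 0" "c + of_nat n \<notin> \<int>\<^sub>\<le>\<^sub>0" by (fact *, fact **)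
  show "c \<noteq> 0" using *[of 0] by simp
  show "c + 1 \<notin> \<int>\<^sub>\<le>\<^sub>0" using **[of 1] by simp
  show "pochhammer c n \<noteq> 0"
    using * by (metis add_eq_0_iff2 pochhammer_eq_0_iff)
qed

lemma Re_pos_imp_not_nonpos_Int: "Re z > 0 \<Longrightarrow> z \<notin> \<int>\<^sub>\<le>\<^sub>0"
  by (auto elim!: nonpos_Ints_cases')

text \<open>\<open>binom_fps d\<close> is the expansion of \<open>(1 - x)\<close> to the power \<open>-d\<close>.\<close>

definition binom_fps :: "'a::field_char_0 \<Rightarrow> 'a fps" where
  "binom_fps d = Abs_fps (\<lambda>n. pochhammer d n / fact n)"

definition gauss_fps :: "'a::field_char_0 \<Rightarrow> 'a \<Rightarrow> 'a \<Rightarrow> 'a fps" where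
  "gauss_fps a b c = Abs_fps (\<lambda>n. pochhammer a n * pochhammer b n / (pochhammer c n * fact n))"

lemma binom_fps_nth [simp]: "binom_fps d $ n = pochhammer d n / fact n"
  by (simp add: binom_fps_def)

lemma gauss_fps_nth [simp]:
  "gauss_fps a b c $ n = pochhammer a n * pochhammer b n / (pochhammer c n * fact n)"
  by (simp add: gauss_fps_def)

section \<open>Binomial and Gauss series, contiguous relations, Euler's transformation\<close>

lemma fps_mult_one_minus_X_nth:
  fixes F :: "'a::comm_ring_1 fps"
  shows "((1 - fps_X) * F) $ n = F $ n - (if n = 0 then 0 else F $ (n - 1))"
  by (simp add: algebra_simps)

text \<open>The coefficients match by the Chu-Vandermonde convolution. Powers of
  \<open>1 - x\<close> thus multiply as expected, and \<open>binom_fps (-d)\<close> inverts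
  \<open>binom_fps d\<close>.\<close>

lemma binom_fps_mult: "binom_fps c * binom_fps d = binom_fps (c + d)"
proof (rule fps_ext)
  fix n
  have "(binom_fps c * binom_fps d) $ n =
      (\<Sum>k\<le>n. of_nat (n choose k) * pochhammer c k * pochhammer d (n - k)) / fact n"
    by (auto simp: fps_mult_nth sum_divide_distrib binomial_fact atLeast0AtMost intro!: sum.cong)
  thus "(binom_fps c * binom_fps d) $ n = binom_fps (c + d) $ n"
    by (simp add: pochhammer_binomial_sum)
qed

lemma binom_fps_0 [simp]: "binom_fps 0 = 1"
  by (rule fps_ext) (auto simp: pochhammer_0_left)

lemma binom_fps_minus_1: "binom_fps (-1) = 1 - fps_X"
proof (rule fps_ext)
  fix n show "binom_fps (-1) $ n = (1 - fps_X :: 'a fps) $ n"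
    using pochhammer_of_nat_eq_0_lemma[of 1 n, where 'a = 'a] 
    by (cases "n = 0"; cases "n = 1") (auto simp: fps_X_def)
qed

lemma fps_deriv_binom_fps: "fps_deriv (binom_fps d) = fps_const d * binom_fps (d + 1)"
proof (rule fps_ext)
  fix n
  have "(1 + of_nat n :: 'a) \<noteq> 0" by (metis of_nat_Suc of_nat_neq_0)
  thus "fps_deriv (binom_fps d) $ n = (fps_const d * binom_fps (d + 1)) $ n"
    by (simp add: pochhammer_rec divide_simps)
qed

lemma fps_deriv_gauss_fps:
  assumes "c \<notin> \<int>\<^sub>\<le>\<^sub>0"
  shows "fps_deriv (gauss_fps a b c) = fps_const (a * b / c) * gauss_fps (a + 1) (b + 1) (c + 1)"
proof (rule fps_ext)
  fix n
  have "(1 + of_nat n :: 'a) \<noteq> 0" by (metis of_nat_Suc of_nat_neq_0)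
  thus "fps_deriv (gauss_fps a b c) $ n =
      (fps_const (a * b / c) * gauss_fps (a + 1) (b + 1) (c + 1)) $ n"
    using nonpos_Ints_shift[OF assms] nonpos_Ints_shift(5)[OF nonpos_Ints_shift(4)[OF assms]]
    by (simp add: pochhammer_rec divide_simps)
qed

text \<open>Serves twice: it turns the derivative in Euler's transformation into a series with
  \<open>c + 1\<close>, and at \<open>x = 1\<close> its term with \<open>1 - fps_X\<close> drops
  out, which gives the recurrence in \<open>c\<close> behind Gauss's theorem.\<close>

lemma gauss_fps_contiguous:
  fixes a b c :: "'a::field_char_0"
  assumes "c \<notin> \<int>\<^sub>\<le>\<^sub>0"
  shows "fps_const ((c - a) * (c - b)) * gauss_fps a b (c + 1) =
    fps_const (a * b) * ((1 - fps_X) * gauss_fps (a + 1) (b + 1) (c + 1)) +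
    fps_const (c * (c - a - b)) * gauss_fps a b c"
proof (rule fps_ext)
  fix n
  show "(fps_const ((c - a) * (c - b)) * gauss_fps a b (c + 1)) $ n =
    (fps_const (a * b) * ((1 - fps_X) * gauss_fps (a + 1) (b + 1) (c + 1)) +
    fps_const (c * (c - a - b)) * gauss_fps a b c) $ n"
  proof (cases n)
    case 0
    thus ?thesis by (simp add: fps_mult_one_minus_X_nth algebra_simps)
  next
    case (Suc k)
    define x y z where "x = pochhammer (a + 1) k" and "y = pochhammer (b + 1) k"
      and "z = pochhammer (c + 1) k"
    have nz: "c \<noteq> 0" "z \<noteq> 0" "(of_nat k + 1 :: 'a) \<noteq> 0" "c + 1 + of_nat k \<noteq> 0"
      using nonpos_Ints_shift[OF assms] nonpos_Ints_shift[OF nonpos_Ints_shift(4)[OF assms]]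
      by (auto simp: z_def) (metis add.commute of_nat_Suc of_nat_neq_0)
    have 1: "pochhammer a n = a * x" "pochhammer b n = b * y" "pochhammer c n = c * z"
      unfolding Suc x_def y_def z_def by (simp_all add: pochhammer_rec)
    have 2: "pochhammer (a + 1) n = x * (a + 1 + of_nat k)"
      "pochhammer (b + 1) n = y * (b + 1 + of_nat k)"
      "pochhammer (c + 1) n = z * (c + 1 + of_nat k)"
      unfolding Suc x_def y_def z_def by (simp_all add: pochhammer_Suc)
    have n: "n \<noteq> 0" "n - 1 = k" using Suc by auto
    have 3: "(fact n :: 'a) = (of_nat k + 1) * fact k" by (simp add: Suc)
    \<comment> \<open>With all Pochhammer symbols reduced to the common factors \<open>x\<close>,
      \<open>y\<close>, \<open>z\<close>, a rational identity in \<open>a\<close>, \<open>b\<close>,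
      \<open>c\<close>, \<open>k\<close> remains.\<close>
    have "(c - a) * (c - b) * (a * x * (b * y) / (z * (c + 1 + of_nat k) * ((of_nat k + 1) * fact k))) =
        a * b * (x * (a + 1 + of_nat k) * (y * (b + 1 + of_nat k)) /
          (z * (c + 1 + of_nat k) * ((of_nat k + 1) * fact k)) - x * y / (z * fact k)) +
        c * (c - a - b) * (a * x * (b * y) / (c * z * ((of_nat k + 1) * fact k)))"
      using nz by (simp add: divide_simps) (simp add: algebra_simps)
    thus ?thesis
      using n by (simp add: fps_mult_one_minus_X_nth 1 2 3 x_def [symmetric] y_def [symmetric]
        z_def [symmetric] del: fact_Suc)
  qed
qed

text \<open>Raises both numerator parameters, so that the product formula for \<open>M\<close>,
  applied to the series on the right, yields the one for \<open>Suc M\<close>. The factor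
  \<open>1 - fps_X\<close> is absorbed into a binomial series by lowering its parameter by
  one.\<close>

lemma gauss_fps_raise_numerators:
  fixes a b c :: "'a::field_char_0"
  assumes "c \<notin> \<int>\<^sub>\<le>\<^sub>0"
  shows "gauss_fps a b c = (1 - fps_X) * gauss_fps (a + 1) (b + 1) c +
    fps_const ((c - a - b - 1) / c) * (fps_X * gauss_fps (a + 1) (b + 1) (c + 1))"
proof (rule fps_ext)
  fix n
  show "gauss_fps a b c $ n = ((1 - fps_X) * gauss_fps (a + 1) (b + 1) c +
    fps_const ((c - a - b - 1) / c) * (fps_X * gauss_fps (a + 1) (b + 1) (c + 1))) $ n"
  proof (cases n)
    case 0
    thus ?thesis by (simp add: fps_mult_one_minus_X_nth)
  next
    case (Suc k)
    define x y z where "x = pochhammer (a + 1) k" and "y = pochhammer (b + 1) k"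
      and "z = pochhammer (c + 1) k"
    have nz: "c \<noteq> 0" "z \<noteq> 0" "(of_nat k + 1 :: 'a) \<noteq> 0" "c + of_nat k \<noteq> 0"
      using nonpos_Ints_shift[OF assms] nonpos_Ints_shift[OF nonpos_Ints_shift(4)[OF assms]]
      by (auto simp: z_def) (metis add.commute of_nat_Suc of_nat_neq_0)
    have 1: "pochhammer a n = a * x" "pochhammer b n = b * y" "pochhammer c n = c * z"
      unfolding Suc x_def y_def z_def by (simp_all add: pochhammer_rec)
    have 2: "pochhammer (a + 1) n = x * (a + 1 + of_nat k)"
      "pochhammer (b + 1) n = y * (b + 1 + of_nat k)"
      unfolding Suc x_def y_def by (simp_all add: pochhammer_Suc)
    have n: "n \<noteq> 0" "n - 1 = k" using Suc by auto
    have 3: "(fact n :: 'a) = (of_nat k + 1) * fact k" by (simp add: Suc)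
    \<comment> \<open>Splitting \<open>pochhammer c (Suc k)\<close> at either end expresses
      \<open>pochhammer c k\<close> through \<open>z\<close>.\<close>
    have "pochhammer c k * (c + of_nat k) = c * z"
      unfolding z_def by (simp flip: pochhammer_rec pochhammer_Suc)
    hence 4: "pochhammer c k = c * z / (c + of_nat k)" using nz by (simp add: field_simps)
    have "a * x * (b * y) / (c * z * ((of_nat k + 1) * fact k)) =
        x * (a + 1 + of_nat k) * (y * (b + 1 + of_nat k)) / (c * z * ((of_nat k + 1) * fact k)) -
        x * y / (c * z / (c + of_nat k) * fact k) + (c - a - b - 1) / c * (x * y / (z * fact k))"
      using nz by (simp add: divide_simps) (simp add: algebra_simps)
    thus ?thesis
      using n by (simp add: fps_mult_one_minus_X_nth 1 2 3 4 x_def [symmetric] y_def [symmetric]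
        z_def [symmetric] del: fact_Suc)
  qed
qed

text \<open>
  Differentiation expresses the coefficient of index \<open>n + 1\<close> for \<open>c\<close> through the one of index
  \<open>n\<close> for \<open>c + 1\<close>, by the contiguous relation \<open>gauss_fps_contiguous\<close>.
\<close>

theorem euler_transformation_fps:
  fixes a b c :: "'a::field_char_0"
  assumes "c \<notin> \<int>\<^sub>\<le>\<^sub>0"
  shows "binom_fps (c - a - b) * gauss_fps a b c = gauss_fps (c - a) (c - b) c"
proof -
  have "(binom_fps (c - a - b) * gauss_fps a b c) $ n = gauss_fps (c - a) (c - b) c $ n" for n
    using assms
  proof (induction n arbitrary: c)
    case (Suc n)
    define d where "d = c - a - b"
    note c = Suc.prems nonpos_Ints_shift[OF Suc.prems]
    have d1: "binom_fps d = (1 - fps_X) * binom_fps (d + 1)"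
      unfolding binom_fps_minus_1[symmetric] binom_fps_mult by simp
    have "fps_deriv (binom_fps d * gauss_fps a b c) =
        fps_const (1 / c) * (binom_fps (d + 1) * (fps_const (a * b) *
          ((1 - fps_X) * gauss_fps (a + 1) (b + 1) (c + 1)) + fps_const (c * d) * gauss_fps a b c))"
    proof -
      have "fps_const (a * b / c) = fps_const (1 / c) * fps_const (a * b)"
        "fps_const d = fps_const (1 / c) * fps_const (c * d)"
        using c by simp_all
      thus ?thesis
        unfolding fps_deriv_mult fps_deriv_binom_fps fps_deriv_gauss_fps[OF c(1)]
        unfolding d1 \<open>fps_const (a * b / c) = _\<close> \<open>fps_const d = _\<close> by (simp only: algebra_simps)
    qed
    also have "\<dots> = fps_const ((c - a) * (c - b) / c) *
        (binom_fps ((c + 1) - a - b) * gauss_fps a b (c + 1))"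
    proof -
      have "fps_const ((c - a) * (c - b) / c) = fps_const (1 / c) * fps_const ((c - a) * (c - b))"
        "c + 1 - a - b = d + 1"
        by (simp_all add: d_def)
      thus ?thesis
        using gauss_fps_contiguous[OF c(1), of a b, symmetric] by (simp only: d_def) (simp only: mult_ac)
    qed
    finally have "of_nat (Suc n) * (binom_fps d * gauss_fps a b c) $ (Suc n) =
        (c - a) * (c - b) / c * gauss_fps (c + 1 - a) (c + 1 - b) (c + 1) $ n"
      using Suc.IH[OF c(5)] by (metis fps_deriv_nth fps_mult_left_const_nth Suc_eq_plus1)
    also have "\<dots> = of_nat (Suc n) * gauss_fps (c - a) (c - b) c $ (Suc n)"
      using c by (simp add: pochhammer_rec algebra_simps divide_simps del: of_nat_Suc)
    finally show ?case
      unfolding d_def using of_nat_neq_0 mult_left_cancel by blast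
  qed simp
  thus ?thesis by (rule fps_ext)
qed

section \<open>Coefficients of a binomial series times a Gauss series, and Stirling numbers\<close>

lemma binomial_pochhammer_recurrence:
  fixes d :: "'a::field_char_0"
  shows "of_nat (Suc n choose Suc i) * pochhammer d (Suc i) =
    of_nat (n choose Suc i) * pochhammer (d - 1) (Suc i) +
    (d + of_nat n) * of_nat (n choose i) * pochhammer d i"
proof -
  have "Suc i * (Suc n choose Suc i) = Suc n * (n choose i)"
    by (rule Suc_times_binomial)
  hence "(of_nat (Suc i * (Suc n choose Suc i)) :: 'a) = of_nat (Suc n * (n choose i))"
    by (simp only:)
  hence *: "(1 + of_nat i) * (of_nat (n choose i) + of_nat (n choose Suc i) :: 'a) =
      (1 + of_nat n) * of_nat (n choose i)"
    by (simp only: of_nat_mult of_nat_Suc binomial_Suc_Suc of_nat_add)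
  \<comment> \<open>The claim without its common factor \<open>pochhammer d i\<close>; it follows
    from the absorption identity and Pascal's rule, combined in \<open>*\<close>.\<close>
  have "of_nat (Suc n choose Suc i) * (d + of_nat i) =
      of_nat (n choose Suc i) * (d - 1) + (d + of_nat n) * of_nat (n choose i)"
    using * by (simp add: algebra_simps)
  moreover have "pochhammer (d - 1) (Suc i) = (d - 1) * pochhammer d i"
    by (simp add: pochhammer_rec)
  ultimately show ?thesis
    by (simp only: pochhammer_Suc[of d] mult.assoc mult.left_commute mult.commute[of _ "pochhammer d i"])
       (simp only: ring_distribs mult.assoc mult.left_commute)
qed

text \<open>Induction on \<open>M\<close>, starting from Euler's transformation at
  \<open>M = 0\<close>. Writing the Pochhammer symbols from index \<open>i\<close> on, instead of as
  quotients, keeps zeros of those with \<open>c - a - M\<close> and \<open>c - b - M\<close> out of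
  the denominators.\<close>

lemma binom_gauss_fps_nth:
  fixes a b c :: "'a::field_char_0"
  assumes "c \<notin> \<int>\<^sub>\<le>\<^sub>0"
  shows "(binom_fps (c - a - b - of_nat M) * gauss_fps a b c) $ N =
    (\<Sum>i\<le>N. of_nat (M choose i) * pochhammer (c - a - b - of_nat M) i *
       pochhammer (c - a - of_nat M + of_nat i) (N - i) *
       pochhammer (c - b - of_nat M + of_nat i) (N - i) / (pochhammer c N * fact (N - i)))"
  using assms
proof (induction M arbitrary: a b c N)
  case 0
  have "(\<Sum>i\<le>N. of_nat (0 choose i) * pochhammer (c - a - b) i *
       pochhammer (c - a + of_nat i) (N - i) *
       pochhammer (c - b + of_nat i) (N - i) / (pochhammer c N * fact (N - i))) =
     (\<Sum>i\<in>{0}. of_nat (0 choose i) * pochhammer (c - a - b) i *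
       pochhammer (c - a + of_nat i) (N - i) *
       pochhammer (c - b + of_nat i) (N - i) / (pochhammer c N * fact (N - i)))"
    by (intro sum.mono_neutral_right) auto
  thus ?case
    using euler_transformation_fps[OF 0, of a b] by (simp add: mult_ac)
next
  case (Suc M)
  note c = Suc.prems nonpos_Ints_shift[OF Suc.prems]
  define D where "D = c - a - b - of_nat (Suc M)"
  define \<alpha> where "\<alpha> = c - a - of_nat (Suc M)"
  define \<beta> where "\<beta> = c - b - of_nat (Suc M)"
  define t where "t = (\<lambda>i. pochhammer (\<alpha> + of_nat i) (N - i) *
       pochhammer (\<beta> + of_nat i) (N - i) / (pochhammer c N * fact (N - i)))"
  have 1: "c - (a + 1) - (b + 1) - of_nat M = D - 1" "c + 1 - (a + 1) - (b + 1) - of_nat M = D"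
    "c - (a + 1) - of_nat M = \<alpha>" "c - (b + 1) - of_nat M = \<beta>"
    "c + 1 - (a + 1) - of_nat M = \<alpha> + 1" "c + 1 - (b + 1) - of_nat M = \<beta> + 1"
    "c - a - b - 1 = D + of_nat M"
    by (simp_all add: D_def \<alpha>_def \<beta>_def)
  have "binom_fps (D - 1) = (1 - fps_X) * binom_fps D"
    unfolding binom_fps_minus_1[symmetric] binom_fps_mult by simp
  hence "binom_fps D * gauss_fps a b c = binom_fps (D - 1) * gauss_fps (a + 1) (b + 1) c +
      fps_X * (fps_const ((D + of_nat M) / c) * (binom_fps D * gauss_fps (a + 1) (b + 1) (c + 1)))"
    unfolding 1(7)[symmetric]
    by (simp only: gauss_fps_raise_numerators[OF c(1), of a b]) (simp only: algebra_simps)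
  hence "(binom_fps D * gauss_fps a b c) $ N =
      (\<Sum>i\<le>N. of_nat (M choose i) * pochhammer (D - 1) i * t i) +
      (if N = 0 then 0 else (D + of_nat M) / c * (\<Sum>i\<le>N - 1. of_nat (M choose i) * pochhammer D i *
       pochhammer (\<alpha> + 1 + of_nat i) (N - 1 - i) *
       pochhammer (\<beta> + 1 + of_nat i) (N - 1 - i) / (pochhammer (c + 1) (N - 1) * fact (N - 1 - i))))"
    using Suc.IH[OF c(1), of "a + 1" "b + 1" N] Suc.IH[OF c(5), of "a + 1" "b + 1" "N - 1"]
    unfolding 1 t_def by (simp only: fps_add_nth fps_X_mult_nth fps_mult_left_const_nth) (simp add: mult_ac)
  also have "\<dots> = (\<Sum>i\<le>N. of_nat (Suc M choose i) * pochhammer D i * t i)"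
  proof (cases N)
    case (Suc n)
    have t: "pochhammer (\<alpha> + 1 + of_nat i) (n - i) * pochhammer (\<beta> + 1 + of_nat i) (n - i) /
        (c * pochhammer (c + 1) n * fact (n - i)) = t (Suc i)" for i
      using Suc by (simp add: t_def pochhammer_rec add_ac)
    have "(D + of_nat M) / c * (\<Sum>i\<le>N - 1. of_nat (M choose i) * pochhammer D i *
       pochhammer (\<alpha> + 1 + of_nat i) (N - 1 - i) *
       pochhammer (\<beta> + 1 + of_nat i) (N - 1 - i) / (pochhammer (c + 1) (N - 1) * fact (N - 1 - i))) =
       (\<Sum>i\<le>n. (D + of_nat M) * of_nat (M choose i) * pochhammer D i * t (Suc i))"
      unfolding t[symmetric] by (simp add: Suc sum_distrib_left mult_ac)
    moreover have "(\<Sum>i\<le>N. of_nat (Suc M choose i) * pochhammer D i * t i) = t 0 +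
        (\<Sum>i\<le>n. of_nat (Suc M choose Suc i) * pochhammer D (Suc i) * t (Suc i))"
      unfolding Suc by (subst sum.atMost_Suc_shift) simp
    moreover have "(\<Sum>i\<le>N. of_nat (M choose i) * pochhammer (D - 1) i * t i) = t 0 +
        (\<Sum>i\<le>n. of_nat (M choose Suc i) * pochhammer (D - 1) (Suc i) * t (Suc i))"
      unfolding Suc by (subst sum.atMost_Suc_shift) simp
    ultimately show ?thesis
      unfolding binomial_pochhammer_recurrence using Suc
      by (simp only: ring_distribs sum.distrib) simp
  qed simp
  finally show ?case
    unfolding D_def[symmetric] \<alpha>_def[symmetric] \<beta>_def[symmetric] t_def by (simp add: mult_ac)
qed

lemma pochhammer_minus_of_nat:
  "pochhammer (- of_nat n) k = ((-1) ^ k * fact k * of_nat (n choose k) :: 'a::field_char_0)"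
proof -
  have "of_nat (n choose k) = (-1) ^ k * pochhammer (- of_nat n :: 'a) k / fact k"
    by (simp add: binomial_gbinomial gbinomial_pochhammer)
  hence "fact k * of_nat (n choose k) = (-1) ^ k * pochhammer (- of_nat n :: 'a) k"
    by simp
  hence "(-1) ^ k * (fact k * of_nat (n choose k)) = ((-1) ^ k * (-1) ^ k) * pochhammer (- of_nat n :: 'a) k"
    by (simp only: mult.assoc)
  also have "(-1) ^ k * (-1) ^ k = (1 :: 'a)"
    by (simp flip: power_mult_distrib)
  finally show ?thesis by (simp add: mult.assoc)
qed

text \<open>The factor in front collects the full symbols \<open>pochhammer \<alpha> N\<close> and
  \<open>pochhammer \<beta> N\<close>; the nonvanishing assumptions allow division by their first
  \<open>i\<close> factors for \<open>i \<le> M\<close>.\<close>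

lemma binom_gauss_fps_nth_3F2:
  fixes \<alpha> \<beta> c d :: complex
  assumes "c \<notin> \<int>\<^sub>\<le>\<^sub>0" "pochhammer (c - a - of_nat M) M \<noteq> 0" "pochhammer (c - b - of_nat M) M \<noteq> 0"
  defines "\<alpha> \<equiv> c - a - of_nat M" and "\<beta> \<equiv> c - b - of_nat M" and "d \<equiv> c - a - b - of_nat M"
  shows "(binom_fps d * gauss_fps a b c) $ N =
    pochhammer \<alpha> N * pochhammer \<beta> N / (pochhammer c N * fact N) *
    (\<Sum>i\<le>M. hypergeom_term [- of_nat M, - of_nat N, d] [\<alpha>, \<beta>] 1 i)"
proof -
  have *: "of_nat (M choose i) * pochhammer d i * pochhammer (\<alpha> + of_nat i) (N - i) *
       pochhammer (\<beta> + of_nat i) (N - i) / (pochhammer c N * fact (N - i)) =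
     pochhammer \<alpha> N * pochhammer \<beta> N / (pochhammer c N * fact N) *
     hypergeom_term [- of_nat M, - of_nat N, d] [\<alpha>, \<beta>] 1 i" if "i \<le> min M N" for i
  proof -
    have nz: "pochhammer \<alpha> i \<noteq> 0" "pochhammer \<beta> i \<noteq> 0"
      using assms(2,3) that unfolding \<alpha>_def \<beta>_def by (meson min.boundedE pochhammer_neq_0_mono)+
    have split: "pochhammer \<alpha> N = pochhammer \<alpha> i * pochhammer (\<alpha> + of_nat i) (N - i)"
      "pochhammer \<beta> N = pochhammer \<beta> i * pochhammer (\<beta> + of_nat i) (N - i)"
      using that by (auto intro: pochhammer_product)
    have "pochhammer (- of_nat N :: complex) i = (-1) ^ i * fact N / fact (N - i)"
      using that by (simp add: pochhammer_minus_of_nat binomial_fact)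
    moreover have "(-1) ^ i * ((-1) ^ i) = (1 :: complex)"
      by (simp flip: power_mult_distrib)
    ultimately have "hypergeom_term [- of_nat M, - of_nat N, d] [\<alpha>, \<beta>] 1 i =
        of_nat (M choose i) * (fact N / fact (N - i)) * pochhammer d i / (pochhammer \<alpha> i * pochhammer \<beta> i)"
      by (simp add: hypergeom_term_altdef pochhammer_minus_of_nat[of M])
    thus ?thesis
      unfolding split using nz by simp
  qed
  have "(binom_fps d * gauss_fps a b c) $ N =
     (\<Sum>i\<le>N. of_nat (M choose i) * pochhammer d i * pochhammer (\<alpha> + of_nat i) (N - i) *
       pochhammer (\<beta> + of_nat i) (N - i) / (pochhammer c N * fact (N - i)))"
    unfolding \<alpha>_def \<beta>_def d_def by (rule binom_gauss_fps_nth) fact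
  also have "\<dots> = (\<Sum>i\<le>min M N. of_nat (M choose i) * pochhammer d i * pochhammer (\<alpha> + of_nat i) (N - i) *
       pochhammer (\<beta> + of_nat i) (N - i) / (pochhammer c N * fact (N - i)))"
    by (intro sum.mono_neutral_right) auto
  also have "\<dots> = (\<Sum>i\<le>min M N. pochhammer \<alpha> N * pochhammer \<beta> N / (pochhammer c N * fact N) *
     hypergeom_term [- of_nat M, - of_nat N, d] [\<alpha>, \<beta>] 1 i)"
    by (intro sum.cong refl *) auto
  \<comment> \<open>Terms with \<open>N < i \<le> M\<close> vanish because of the parameter
    \<open>- of_nat N\<close>, so the range of summation becomes independent of
    \<open>N\<close>.\<close>
  also have "\<dots> = (\<Sum>i\<le>M. pochhammer \<alpha> N * pochhammer \<beta> N / (pochhammer c N * fact N) *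
     hypergeom_term [- of_nat M, - of_nat N, d] [\<alpha>, \<beta>] 1 i)"
    by (intro sum.mono_neutral_left) (auto simp: hypergeom_term_altdef pochhammer_minus_of_nat)
  finally show ?thesis by (simp add: sum_distrib_left)
qed

text \<open>The falling factorial of \<open>n\<close> is written as
  \<open>fact k * (n choose k)\<close>, which avoids subtraction on natural numbers; the induction
  step multiplies it by \<open>n = (n - k) + k\<close>.\<close>

lemma power_eq_sum_Stirling:
  "n ^ j = (\<Sum>k\<le>j. Stirling j k * (fact k * (n choose k)))"
proof (induction j)
  case (Suc j)
  have *: "n * (fact k * (n choose k)) = fact (Suc k) * (n choose Suc k) + k * (fact k * (n choose k))" for k
  proof -
    have "Suc k * ((n choose k) + (n choose Suc k)) = Suc n * (n choose k)"
      using Suc_times_binomial[of k n] by simp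
    hence "Suc k * (n choose Suc k) + k * (n choose k) = n * (n choose k)"
      by (simp add: distrib_left)
    hence "fact k * (Suc k * (n choose Suc k) + k * (n choose k)) = fact k * (n * (n choose k))"
      by (simp only:)
    thus ?thesis by (simp add: algebra_simps)
  qed
  have "n ^ Suc j = (\<Sum>k\<le>j. Stirling j k * (fact (Suc k) * (n choose Suc k))) +
      (\<Sum>k\<le>j. k * Stirling j k * (fact k * (n choose k)))"
    unfolding power_Suc Suc.IH sum_distrib_left sum.distrib[symmetric]
  proof (intro sum.cong refl)
    fix k
    have "n * (Stirling j k * (fact k * (n choose k))) = Stirling j k * (n * (fact k * (n choose k)))"
      by simp
    thus "n * (Stirling j k * (fact k * (n choose k))) = Stirling j k * (fact (Suc k) * (n choose Suc k)) +
        k * Stirling j k * (fact k * (n choose k))"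
      unfolding * by (simp only: algebra_simps)
  qed
  also have "(\<Sum>k\<le>j. k * Stirling j k * (fact k * (n choose k))) =
      (\<Sum>k\<le>Suc j. k * Stirling j k * (fact k * (n choose k)))"
    by simp
  also have "\<dots> = (\<Sum>k\<le>j. Suc k * Stirling j (Suc k) * (fact (Suc k) * (n choose Suc k)))"
    by (subst sum.atMost_Suc_shift) simp
  finally have "n ^ Suc j = (\<Sum>k\<le>j. Stirling (Suc j) (Suc k) * (fact (Suc k) * (n choose Suc k)))"
    by (simp add: algebra_simps sum.distrib)
  thus ?case
    by (subst sum.atMost_Suc_shift) simp
qed simp

subsection \<open>The transformation of the generating function\<close>

text \<open>After cross-multiplication both sides are \<open>pochhammer f (n + k)\<close>. The
  right-hand side exhibits the ratio as a polynomial in \<open>k\<close> of degree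
  \<open>n\<close>.\<close>

lemma pochhammer_ratio_swap:
  fixes f :: "'a::field_char_0"
  assumes "f \<notin> \<int>\<^sub>\<le>\<^sub>0"
  shows "pochhammer (f + of_nat n) k / pochhammer f k = pochhammer (f + of_nat k) n / pochhammer f n"
proof -
  have "pochhammer f n * pochhammer (f + of_nat n) k = pochhammer f k * pochhammer (f + of_nat k) n"
    by (metis add.commute pochhammer_product')
  thus ?thesis
    using nonpos_Ints_shift(5)[OF assms] by (simp add: field_simps)
qed

lemma Lambda_prod_nonzero:
  assumes "length fs = length ms" "\<forall>f\<in>set fs. f \<notin> \<int>\<^sub>\<le>\<^sub>0"
  shows "Lambda_prod fs ms \<noteq> 0"
  using assms unfolding Lambda_prod_def
  by (induction fs ms rule: list_induct2) (auto simp: nonpos_Ints_shift(5))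

lemma prod_pochhammer_pairs:
  assumes "length fs = length ms" "\<forall>f\<in>set fs. f \<notin> \<int>\<^sub>\<le>\<^sub>0"
  shows "(\<Prod>f\<leftarrow>map2 (\<lambda>f n. f + of_nat n) fs ms. pochhammer f k) / (\<Prod>f\<leftarrow>fs. pochhammer f k) =
    (\<Prod>(f, n)\<leftarrow>zip fs ms. pochhammer (f + of_nat k) n) / Lambda_prod fs ms"
  using assms unfolding Lambda_prod_def
proof (induction fs ms rule: list_induct2)
  case (Cons f fs n ms)
  have "(pochhammer (f + of_nat n) k / pochhammer f k) *
      ((\<Prod>f\<leftarrow>map2 (\<lambda>f n. f + of_nat n) fs ms. pochhammer f k) / (\<Prod>f\<leftarrow>fs. pochhammer f k)) =
    (pochhammer (f + of_nat k) n / pochhammer f n) *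
      ((\<Prod>(f, n)\<leftarrow>zip fs ms. pochhammer (f + of_nat k) n) / (\<Prod>(f, n)\<leftarrow>zip fs ms. pochhammer f n))"
    using Cons by (intro arg_cong2[of _ _ _ _ "(*)"] pochhammer_ratio_swap) auto
  thus ?case by simp
qed simp

text \<open>The property for which \<open>C_coeff\<close> is built: its values are the coefficients
  of the product of pair ratios in the basis of falling factorials of \<open>k\<close>.\<close>

lemma sum_C_coeff_falling:
  assumes "length fs = length ms"
  shows "(\<Sum>l\<le>sum_list ms. C_coeff fs ms l * (fact l * of_nat (k choose l))) =
    (\<Prod>(f, n)\<leftarrow>zip fs ms. pochhammer (f + of_nat k) n) / Lambda_prod fs ms"
proof -
  define m where "m = sum_list ms"
  have pow: "(\<Sum>l\<le>m. of_nat (Stirling j l) * (fact l * of_nat (k choose l))) = (of_nat k ^ j :: complex)"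
    if "j \<le> m" for j
  proof -
    have "(of_nat k ^ j :: complex) = of_nat (\<Sum>l\<le>j. Stirling j l * (fact l * (k choose l)))"
      by (simp flip: power_eq_sum_Stirling)
    also have "\<dots> = (\<Sum>l\<le>j. of_nat (Stirling j l) * (fact l * of_nat (k choose l)))"
      by simp
    also have "\<dots> = (\<Sum>l\<le>m. of_nat (Stirling j l) * (fact l * of_nat (k choose l)))"
      using that by (intro sum.mono_neutral_left) auto
    finally show ?thesis ..
  qed
  \<comment> \<open>Since \<open>Stirling j l = 0\<close> for \<open>j < l\<close>, the sum may run
    over all \<open>j \<le> m\<close>; a rectangular range lets the two summations be
    exchanged.\<close>
  have "C_coeff fs ms l = 1 / Lambda_prod fs ms * (\<Sum>j\<le>m. sigma_coeff fs ms j * of_nat (Stirling j l))" for l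
  proof -
    have "(\<Sum>j=l..m. sigma_coeff fs ms j * of_nat (Stirling j l)) =
        (\<Sum>j\<le>m. sigma_coeff fs ms j * of_nat (Stirling j l))"
      by (intro sum.mono_neutral_left) auto
    thus ?thesis by (simp add: C_coeff_def m_def)
  qed
  hence "(\<Sum>l\<le>m. C_coeff fs ms l * (fact l * of_nat (k choose l))) =
      (\<Sum>l\<le>m. \<Sum>j\<le>m. sigma_coeff fs ms j *
        (of_nat (Stirling j l) * (fact l * of_nat (k choose l)))) / Lambda_prod fs ms"
    by (simp add: sum_distrib_left sum_distrib_right sum_divide_distrib mult_ac)
  also have "\<dots> = (\<Sum>j\<le>m. sigma_coeff fs ms j *
        (\<Sum>l\<le>m. of_nat (Stirling j l) * (fact l * of_nat (k choose l)))) / Lambda_prod fs ms"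
    by (subst sum.swap) (simp add: sum_distrib_left)
  also have "\<dots> = (\<Sum>j\<le>m. sigma_coeff fs ms j * of_nat k ^ j) / Lambda_prod fs ms"
    by (intro arg_cong2[of _ _ _ _ "(/)"] sum.cong refl) (simp add: pow)
  also have "\<dots> = (\<Prod>(f, n)\<leftarrow>zip fs ms. pochhammer (f + of_nat k) n) / Lambda_prod fs ms"
    using sigma_coeff_identity[OF assms, of "of_nat k"] by (simp add: m_def atLeast0AtMost)
  finally show ?thesis by (simp add: m_def)
qed

lemma hypergeom_term_shifted_pairs:
  assumes "length fs = length ms" "\<forall>f\<in>set fs. f \<notin> \<int>\<^sub>\<le>\<^sub>0"
  shows "hypergeom_term (as @ map2 (\<lambda>f n. f + of_nat n) fs ms) (bs @ fs) x k =
    hypergeom_term as bs x k * (\<Sum>l\<le>sum_list ms. C_coeff fs ms l * (fact l * of_nat (k choose l)))"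
proof -
  have "hypergeom_term (as @ map2 (\<lambda>f n. f + of_nat n) fs ms) (bs @ fs) x k =
    hypergeom_term as bs x k * ((\<Prod>f\<leftarrow>map2 (\<lambda>f n. f + of_nat n) fs ms. pochhammer f k) /
      (\<Prod>f\<leftarrow>fs. pochhammer f k))"
    unfolding hypergeom_term_altdef by (simp add: mult_ac)
  thus ?thesis
    unfolding prod_pochhammer_pairs[OF assms] sum_C_coeff_falling[OF assms(1)] .
qed

text \<open>The falling factorial \<open>fact l * (n choose l)\<close> removes the coefficients
  below \<open>l\<close> and replaces \<open>1 / fact n\<close> by \<open>1 / fact (n - l)\<close>,
  which leaves a Gauss series with all parameters shifted by \<open>l\<close>.\<close>

lemma sum_falling_gauss_fps:
  fixes a b c :: complex
  assumes "c \<notin> \<int>\<^sub>\<le>\<^sub>0"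
  shows "Abs_fps (\<lambda>n. hypergeom_term [a, b] [c] 1 n * (\<Sum>l\<le>m. C l * (fact l * of_nat (n choose l)))) =
    (\<Sum>l\<le>m. fps_const (C l * pochhammer a l * pochhammer b l / pochhammer c l) *
      (fps_X ^ l * gauss_fps (a + of_nat l) (b + of_nat l) (c + of_nat l)))" (is "?L = ?R")
proof (rule fps_ext)
  fix n
  have "hypergeom_term [a, b] [c] 1 n * (C l * (fact l * of_nat (n choose l))) =
      (fps_const (C l * pochhammer a l * pochhammer b l / pochhammer c l) *
      (fps_X ^ l * gauss_fps (a + of_nat l) (b + of_nat l) (c + of_nat l))) $ n" for l
  proof (cases "l \<le> n")
    case True
    have split: "pochhammer z n = pochhammer z l * pochhammer (z + of_nat l) (n - l)" for z :: complex
      by (rule pochhammer_product) fact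
    show ?thesis
      using True unfolding fps_mult_left_const_nth fps_X_power_mult_nth hypergeom_term_altdef
      by (simp add: split binomial_fact mult_ac)
  qed (simp add: fps_X_power_mult_nth)
  thus "?L $ n = ?R $ n"
    by (simp add: sum_distrib_left fps_sum_nth del: fps_mult_left_const_nth)
qed

text \<open>Each shifted Gauss series is treated with \<open>M = m - l\<close>; this choice makes
  the exponent \<open>D\<close> the same for all \<open>l\<close>, so one binomial factor serves the
  whole sum.\<close>

theorem miller_paris_fps:
  fixes a b c :: complex and fs :: "complex list" and ms :: "nat list"
  defines "m \<equiv> sum_list ms"
  assumes c: "c \<notin> \<int>\<^sub>\<le>\<^sub>0"
    and nz: "pochhammer (c - a - of_nat m) m \<noteq> 0" "pochhammer (c - b - of_nat m) m \<noteq> 0"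
  shows "(binom_fps (c - a - b - of_nat m) * Abs_fps (\<lambda>n. hypergeom_term [a, b] [c] 1 n *
      (\<Sum>l\<le>m. C_coeff fs ms l * (fact l * of_nat (n choose l))))) $ n =
    hypergeom_term [c - a - of_nat m, c - b - of_nat m] [c] 1 n * Qhat a b c fs ms (- of_nat n)"
proof -
  define \<alpha> \<beta> D where "\<alpha> = c - a - of_nat m" and "\<beta> = c - b - of_nat m"
    and "D = c - a - b - of_nat m"
  have summand: "(binom_fps D * (fps_const (C_coeff fs ms l * pochhammer a l * pochhammer b l / pochhammer c l) *
      (fps_X ^ l * gauss_fps (a + of_nat l) (b + of_nat l) (c + of_nat l)))) $ n =
    hypergeom_term [\<alpha>, \<beta>] [c] 1 n *
    ((-1) ^ l * C_coeff fs ms l * pochhammer a l * pochhammer b l * pochhammer (- of_nat n) l /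
      (pochhammer \<alpha> l * pochhammer \<beta> l) * G_fun m l a b c (- of_nat n))" (is "?L = ?R") if l: "l \<le> m" for l
  proof -
    have "?L = C_coeff fs ms l * pochhammer a l * pochhammer b l / pochhammer c l *
        (if n < l then 0 else (binom_fps D * gauss_fps (a + of_nat l) (b + of_nat l) (c + of_nat l)) $ (n - l))"
      by (simp only: mult.left_commute[of "binom_fps D"] fps_mult_left_const_nth fps_X_power_mult_nth)
    also have "\<dots> = ?R"
    proof (cases "l \<le> n")
      case True
      have shift: "c + of_nat l - (a + of_nat l) - of_nat (m - l) = \<alpha> + of_nat l"
        "c + of_nat l - (b + of_nat l) - of_nat (m - l) = \<beta> + of_nat l"
        "c + of_nat l - (a + of_nat l) - (b + of_nat l) - of_nat (m - l) = D"
        using l by (simp_all add: \<alpha>_def \<beta>_def D_def of_nat_diff)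
      have split: "pochhammer z n = pochhammer z l * pochhammer (z + of_nat l) (n - l)"
        "pochhammer z m = pochhammer z l * pochhammer (z + of_nat l) (m - l)" for z :: complex
        using l True by (auto intro: pochhammer_product)
      have nz': "pochhammer (\<alpha> + of_nat l) (m - l) \<noteq> 0" "pochhammer (\<beta> + of_nat l) (m - l) \<noteq> 0"
        "pochhammer \<alpha> l \<noteq> 0" "pochhammer \<beta> l \<noteq> 0"
        using nz unfolding \<alpha>_def[symmetric] \<beta>_def[symmetric] split(2) by auto
      have "(binom_fps D * gauss_fps (a + of_nat l) (b + of_nat l) (c + of_nat l)) $ (n - l) =
          pochhammer (\<alpha> + of_nat l) (n - l) * pochhammer (\<beta> + of_nat l) (n - l) /
            (pochhammer (c + of_nat l) (n - l) * fact (n - l)) *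
          (\<Sum>i\<le>m - l. hypergeom_term [- of_nat (m - l), - of_nat (n - l), D]
             [\<alpha> + of_nat l, \<beta> + of_nat l] 1 i)"
        using binom_gauss_fps_nth_3F2[OF nonpos_Ints_shift(3)[OF c, of l], where a = "a + of_nat l"
          and b = "b + of_nat l" and M = "m - l" and N = "n - l"] nz' unfolding shift by blast
      \<comment> \<open>\<open>- of_nat (n - l)\<close> is \<open>t + of_nat l\<close> at
        \<open>t = - of_nat n\<close>, the second numerator parameter in
        \<open>G_fun\<close>.\<close>
      also have "(\<Sum>i\<le>m - l. hypergeom_term [- of_nat (m - l), - of_nat (n - l), D]
             [\<alpha> + of_nat l, \<beta> + of_nat l] 1 i) = G_fun m l a b c (- of_nat n)"
        using l True by (simp add: G_fun_def \<alpha>_def \<beta>_def D_def of_nat_diff atLeast0AtMost)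
      finally have eq: "(binom_fps D * gauss_fps (a + of_nat l) (b + of_nat l) (c + of_nat l)) $ (n - l) =
          pochhammer (\<alpha> + of_nat l) (n - l) * pochhammer (\<beta> + of_nat l) (n - l) /
            (pochhammer (c + of_nat l) (n - l) * fact (n - l)) * G_fun m l a b c (- of_nat n)" .
      have "pochhammer (- of_nat n :: complex) l = (-1) ^ l * fact n / fact (n - l)"
        using True by (simp add: pochhammer_minus_of_nat binomial_fact)
      moreover have "(-1) ^ l * ((-1) ^ l) = (1 :: complex)"
        by (simp flip: power_mult_distrib)
      ultimately have "(-1) ^ l * pochhammer (- of_nat n :: complex) l = fact n / fact (n - l)"
        by simp
      hence R: "?R = hypergeom_term [\<alpha>, \<beta>] [c] 1 n *
        (C_coeff fs ms l * pochhammer a l * pochhammer b l * (fact n / fact (n - l)) /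
          (pochhammer \<alpha> l * pochhammer \<beta> l) * G_fun m l a b c (- of_nat n))"
        by (simp only: times_divide_eq_left times_divide_eq_right mult_ac)
      show ?thesis
        unfolding R unfolding eq hypergeom_term_altdef using True nz' by (simp add: split(1) mult_ac)
    \<comment> \<open>For \<open>n < l\<close> the left side is zero by the shift
      \<open>fps_X ^ l\<close>, the right side by
      \<open>pochhammer (- of_nat n) l = 0\<close>.\<close>
    qed (auto simp: pochhammer_minus_of_nat)
    finally show ?thesis .
  qed
  have "(binom_fps D * Abs_fps (\<lambda>n. hypergeom_term [a, b] [c] 1 n *
      (\<Sum>l\<le>m. C_coeff fs ms l * (fact l * of_nat (n choose l))))) $ n =
     (\<Sum>l\<le>m. (binom_fps D * (fps_const (C_coeff fs ms l * pochhammer a l * pochhammer b l / pochhammer c l) *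
      (fps_X ^ l * gauss_fps (a + of_nat l) (b + of_nat l) (c + of_nat l)))) $ n)"
    unfolding sum_falling_gauss_fps[OF c] by (simp only: sum_distrib_left fps_sum_nth)
  also have "\<dots> = hypergeom_term [\<alpha>, \<beta>] [c] 1 n * Qhat a b c fs ms (- of_nat n)"
    unfolding Qhat_def Let_def sum_distrib_left m_def[symmetric] atLeast0AtMost \<alpha>_def[symmetric] \<beta>_def[symmetric]
    by (intro sum.cong refl summand) auto
  finally show ?thesis
    unfolding D_def \<alpha>_def \<beta>_def .
qed

subsection \<open>Growth of coefficients and Gauss's summation theorem\<close>

text \<open>The base \<open>n + 1\<close> keeps the bound meaningful at \<open>n = 0\<close>, so
  that one constant covers all indices.\<close>

definition growth_le :: "(nat \<Rightarrow> 'a::real_normed_vector) \<Rightarrow> real \<Rightarrow> bool" where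
  "growth_le f p \<longleftrightarrow> (\<exists>K. \<forall>n. norm (f n) \<le> K * (real n + 1) powr p)"

lemma growth_leE:
  assumes "growth_le f p"
  obtains K where "K \<ge> 0" "\<And>n. norm (f n) \<le> K * (real n + 1) powr p"
proof -
  from assms obtain K where K: "\<And>n. norm (f n) \<le> K * (real n + 1) powr p"
    by (auto simp: growth_le_def)
  from K[of 0] have "K \<ge> 0" by (auto intro: order_trans[OF norm_ge_zero])
  with K show ?thesis using that by blast
qed

lemma growth_le_mult:
  fixes f g :: "nat \<Rightarrow> 'a::real_normed_algebra"
  assumes "growth_le f p" "growth_le g q"
  shows "growth_le (\<lambda>n. f n * g n) (p + q)"
proof -
  obtain K L where K: "K \<ge> 0" "\<And>n. norm (f n) \<le> K * (real n + 1) powr p"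
    and L: "L \<ge> 0" "\<And>n. norm (g n) \<le> L * (real n + 1) powr q"
    using assms by (auto elim!: growth_leE)
  have "norm (f n * g n) \<le> (K * L) * (real n + 1) powr (p + q)" for n
  proof -
    have "norm (f n * g n) \<le> norm (f n) * norm (g n)" by (rule norm_mult_ineq)
    also have "\<dots> \<le> (K * (real n + 1) powr p) * (L * (real n + 1) powr q)"
      using K L by (intro mult_mono) auto
    finally show ?thesis by (simp add: powr_add mult_ac)
  qed
  thus ?thesis unfolding growth_le_def by blast
qed

lemma growth_le_imp_summable:
  assumes "growth_le f p" "p < -1"
  shows "summable (\<lambda>n. norm (f n))"
proof -
  obtain K where K: "K \<ge> 0" "\<And>n. norm (f n) \<le> K * (real n + 1) powr p"
    using assms(1) by (auto elim!: growth_leE)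
  have "summable (\<lambda>n. real n powr p)"
    using assms(2) by (simp add: summable_real_powr_iff)
  hence "summable (\<lambda>n. K * real (Suc n) powr p)"
    by (intro summable_mult) (subst summable_Suc_iff)
  thus ?thesis
    by (rule summable_comparison_test'[where N = 0]) (use K in \<open>simp add: add_ac\<close>)
qed

lemma growth_le_imp_tendsto_0:
  assumes "growth_le f p" "p < 0"
  shows "f \<longlonglongrightarrow> 0"
proof -
  obtain K where K: "K \<ge> 0" "\<And>n. norm (f n) \<le> K * (real n + 1) powr p"
    using assms(1) by (auto elim!: growth_leE)
  have "(\<lambda>n. K * (real n + 1) powr p) \<longlonglongrightarrow> 0"
    using assms(2) by real_asymp
  thus ?thesis by (rule Lim_null_comparison[rotated]) (use K in auto)
qed

text \<open>A convergent sequence is bounded, which supplies the constant. The index is shifted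
  because the series for \<open>Gamma\<close> and \<open>rGamma\<close> involve
  \<open>pochhammer z (Suc n)\<close>.\<close>

lemma growth_leI_tendsto:
  assumes "(\<lambda>n. norm (f (Suc n)) * (real n + 2) powr (-p)) \<longlonglongrightarrow> L"
  shows "growth_le f p"
proof -
  have "Bseq (\<lambda>n. norm (f (Suc n)) * (real (Suc n) + 1) powr (-p))"
    using convergent_imp_Bseq[OF convergentI[OF assms]] by (simp add: add_ac)
  hence "Bseq (\<lambda>n. norm (f n) * (real n + 1) powr (-p))"
    by (subst (asm) Bseq_Suc_iff)
  then obtain K where "\<And>n. norm (norm (f n) * (real n + 1) powr (-p)) \<le> K"
    by (auto simp: Bseq_def)
  hence "norm (f n) \<le> K * (real n + 1) powr p" for n
    by (simp add: powr_minus field_simps)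
  thus ?thesis unfolding growth_le_def by blast
qed

text \<open>Read off from the convergence of \<open>rGamma_series z n\<close> to
  \<open>rGamma z\<close>, which holds for every \<open>z\<close>, including the zeros of
  \<open>rGamma\<close>.\<close>

lemma growth_pochhammer:
  fixes z :: complex
  shows "growth_le (\<lambda>n. pochhammer z n / fact n) (Re z - 1)"
proof (rule growth_leI_tendsto)
  \<comment> \<open>The extra factor tends to \<open>1\<close>; it trades \<open>n powr Re z\<close>
    and the \<open>n + 1\<close> from \<open>fact (Suc n)\<close> for the power of
    \<open>n + 2\<close> in \<open>growth_leI_tendsto\<close>.\<close>
  have "(\<lambda>n. norm (rGamma_series z n) * (real n powr Re z * (real n + 2) powr (1 - Re z) / (real n + 1)))
      \<longlonglongrightarrow> norm (rGamma z) * 1"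
    by (intro tendsto_intros) real_asymp
  also have "?this \<longleftrightarrow> (\<lambda>n. norm (pochhammer z (Suc n) / fact (Suc n)) * (real n + 2) powr - (Re z - 1))
      \<longlonglongrightarrow> norm (rGamma z) * 1"
  proof (intro filterlim_cong refl eventually_mono[OF eventually_gt_at_top[of 0]])
    fix n :: nat assume n: "n > 0"
    have "norm (exp (z * of_real (ln (real n)))) = real n powr Re z"
      using n by (simp add: powr_def mult.commute)
    moreover have "norm (fact (Suc n) :: complex) = (real n + 1) * fact n"
      unfolding norm_fact by simp
    ultimately show "norm (rGamma_series z n) * (real n powr Re z * (real n + 2) powr (1 - Re z) / (real n + 1)) =
        norm (pochhammer z (Suc n) / fact (Suc n)) * (real n + 2) powr - (Re z - 1)"
      using n by (simp add: rGamma_series_def norm_divide norm_mult field_simps del: fact_Suc)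
  qed
  finally show "(\<lambda>n. norm (pochhammer z (Suc n) / fact (Suc n)) * (real n + 2) powr - (Re z - 1))
      \<longlonglongrightarrow> norm (rGamma z) * 1" .
qed

lemma growth_inverse_pochhammer:
  fixes z :: complex
  assumes "z \<notin> \<int>\<^sub>\<le>\<^sub>0"
  shows "growth_le (\<lambda>n. fact n / pochhammer z n) (1 - Re z)"
proof (rule growth_leI_tendsto)
  have "(\<lambda>n. norm (Gamma_series z n) * ((real n + 1) * (real n + 2) powr (Re z - 1) / real n powr Re z))
      \<longlonglongrightarrow> norm (Gamma z) * 1"
    by (intro tendsto_intros) real_asymp
  also have "?this \<longleftrightarrow> (\<lambda>n. norm (fact (Suc n) / pochhammer z (Suc n)) * (real n + 2) powr - (1 - Re z))
      \<longlonglongrightarrow> norm (Gamma z) * 1"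
  proof (intro filterlim_cong refl eventually_mono[OF eventually_gt_at_top[of 0]])
    fix n :: nat assume n: "n > 0"
    have "norm (exp (z * of_real (ln (real n)))) = real n powr Re z"
      using n by (simp add: powr_def mult.commute)
    moreover have "norm (fact (Suc n) :: complex) = (real n + 1) * fact n"
      unfolding norm_fact by simp
    ultimately show "norm (Gamma_series z n) * ((real n + 1) * (real n + 2) powr (Re z - 1) / real n powr Re z) =
        norm (fact (Suc n) / pochhammer z (Suc n)) * (real n + 2) powr - (1 - Re z)"
      using n nonpos_Ints_shift(5)[OF assms, of "Suc n"]
      by (simp add: Gamma_series_def norm_divide norm_mult field_simps del: fact_Suc)
  qed
  finally show "(\<lambda>n. norm (fact (Suc n) / pochhammer z (Suc n)) * (real n + 2) powr - (1 - Re z))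
      \<longlonglongrightarrow> norm (Gamma z) * 1" .
qed

lemma growth_pochhammer_quotient:
  fixes a c :: complex
  assumes "c \<notin> \<int>\<^sub>\<le>\<^sub>0"
  shows "growth_le (\<lambda>n. pochhammer a n / pochhammer c n) (Re a - Re c)"
  using growth_le_mult[OF growth_pochhammer[of a] growth_inverse_pochhammer[OF assms]] by simp

lemma growth_gauss_fps:
  fixes a b c :: complex
  assumes "c \<notin> \<int>\<^sub>\<le>\<^sub>0"
  shows "growth_le (\<lambda>n. gauss_fps a b c $ n) (Re (a + b - c) - 1)"
  using growth_le_mult[OF growth_pochhammer_quotient[OF assms, of a] growth_pochhammer[of b]] 
  by (simp add: algebra_simps)

section \<open>Gauss's summation theorem\<close>

lemma summable_gauss_fps:
  fixes a b c :: complex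
  assumes "c \<notin> \<int>\<^sub>\<le>\<^sub>0" "Re (c - a - b) > 0"
  shows "summable (\<lambda>n. norm (gauss_fps a b c $ n))"
  using growth_le_imp_summable[OF growth_gauss_fps[OF assms(1), of a b]] assms(2) by simp

text \<open>Sums \<open>gauss_fps_contiguous\<close> at \<open>x = 1\<close>. The term with
  \<open>1 - fps_X\<close> telescopes to the limit of the coefficients \<open>u\<close>, which is
  zero since their growth exponent \<open>Re (a + b - c)\<close> is negative.\<close>

lemma gauss_series_contiguous:
  fixes a b c :: complex
  assumes "c \<notin> \<int>\<^sub>\<le>\<^sub>0" "Re (c - a - b) > 0"
  shows "(c - a) * (c - b) * (\<Sum>n. gauss_fps a b (c + 1) $ n) =
    c * (c - a - b) * (\<Sum>n. gauss_fps a b c $ n)"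
proof -
  define u where "u = (\<lambda>n. gauss_fps (a + 1) (b + 1) (c + 1) $ n)"
  note c1 = nonpos_Ints_shift(4)[OF assms(1)]
  have "u \<longlonglongrightarrow> 0"
    unfolding u_def using growth_le_imp_tendsto_0[OF growth_gauss_fps[OF c1, of "a + 1" "b + 1"]] assms(2)
    by (simp del: gauss_fps_nth)
  moreover have "(\<Sum>i\<le>n. ((1 - fps_X) * gauss_fps (a + 1) (b + 1) (c + 1)) $ i) = u n" for n
    by (induction n) (auto simp: fps_mult_one_minus_X_nth u_def)
  ultimately have "(\<lambda>n. ((1 - fps_X) * gauss_fps (a + 1) (b + 1) (c + 1)) $ n) sums 0"
    by (simp add: sums_def_le)
  moreover have "(\<lambda>n. gauss_fps a b c $ n) sums (\<Sum>n. gauss_fps a b c $ n)"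
    by (intro summable_sums summable_norm_cancel[OF summable_gauss_fps] assms)
  ultimately have "(\<lambda>n. (fps_const (a * b) * ((1 - fps_X) * gauss_fps (a + 1) (b + 1) (c + 1)) +
      fps_const (c * (c - a - b)) * gauss_fps a b c) $ n) sums
      (a * b * 0 + c * (c - a - b) * (\<Sum>n. gauss_fps a b c $ n))"
    unfolding fps_add_nth fps_mult_left_const_nth by (intro sums_add sums_mult)
  hence "(\<lambda>n. (c - a) * (c - b) * gauss_fps a b (c + 1) $ n) sums
      (c * (c - a - b) * (\<Sum>n. gauss_fps a b c $ n))"
    unfolding gauss_fps_contiguous[OF assms(1), symmetric] by (simp only: fps_mult_left_const_nth mult_zero_right add_0)
  moreover have "(\<lambda>n. (c - a) * (c - b) * gauss_fps a b (c + 1) $ n) sums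
      ((c - a) * (c - b) * (\<Sum>n. gauss_fps a b (c + 1) $ n))"
    using assms c1 by (intro sums_mult summable_sums summable_norm_cancel[OF summable_gauss_fps]) auto
  ultimately show ?thesis using sums_unique2 by blast
qed

text \<open>Iterates the recurrence in \<open>c\<close>. The form is free of division because
  \<open>c - a\<close> or \<open>c - b\<close> may reach zero under the shifts.\<close>

lemma gauss_series_shift:
  fixes a b c :: complex
  assumes "c \<notin> \<int>\<^sub>\<le>\<^sub>0" "Re (c - a - b) > 0"
  shows "pochhammer (c - a) n * pochhammer (c - b) n * (\<Sum>k. gauss_fps a b (c + of_nat n) $ k) =
    pochhammer c n * pochhammer (c - a - b) n * (\<Sum>k. gauss_fps a b c $ k)"
proof (induction n)
  case (Suc n)
  have "(c + of_nat n - a) * (c + of_nat n - b) * (\<Sum>k. gauss_fps a b (c + of_nat n + 1) $ k) =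
      (c + of_nat n) * (c + of_nat n - a - b) * (\<Sum>k. gauss_fps a b (c + of_nat n) $ k)"
    using assms nonpos_Ints_shift(3)[OF assms(1)] by (intro gauss_series_contiguous) auto
  hence "pochhammer (c - a) (Suc n) * pochhammer (c - b) (Suc n) * (\<Sum>k. gauss_fps a b (c + of_nat (Suc n)) $ k) =
      (c + of_nat n) * (c + of_nat n - a - b) *
      (pochhammer (c - a) n * pochhammer (c - b) n * (\<Sum>k. gauss_fps a b (c + of_nat n) $ k))"
    by (simp add: pochhammer_Suc add_ac add_diff_eq diff_add_eq mult_ac del: gauss_fps_nth)
  thus ?case
    unfolding Suc.IH by (simp add: pochhammer_Suc algebra_simps del: gauss_fps_nth)
qed (simp del: gauss_fps_nth)

text \<open>Bounds complex denominators from below by a real Pochhammer symbol, uniformly once the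
  real part is large.\<close>

lemma norm_pochhammer_ge:
  fixes z :: complex
  assumes "0 \<le> x" "x \<le> Re z"
  shows "pochhammer x n \<le> norm (pochhammer z n)"
proof (induction n)
  case (Suc n)
  have "x + real n \<le> Re (z + of_nat n)" using assms by simp
  also have "\<dots> \<le> norm (z + of_nat n)" by (rule complex_Re_le_cmod)
  finally show ?case
    unfolding pochhammer_Suc norm_mult using Suc assms by (intro mult_mono) auto
qed simp

text \<open>Tannery's theorem: for fixed \<open>k > 0\<close> the coefficient tends to zero, and for
  \<open>n \<ge> N\<close> all the series are dominated by the one with the real parameter
  \<open>x\<close>.\<close>

lemma gauss_series_tendsto_1:
  fixes a b c :: complex
  shows "(\<lambda>n. \<Sum>k. gauss_fps a b (c + of_nat n) $ k) \<longlonglongrightarrow> 1"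
proof -
  \<comment> \<open>\<open>N\<close> is large enough for \<open>x \<ge> 1\<close>, used in the lower
    bounds on denominators, and for \<open>x > Re (a + b)\<close>, which makes the majorant
    converge.\<close>
  define N where "N = nat \<lceil>max 1 (Re (a + b) + 1) - Re c\<rceil>"
  define x where "x = Re c + real N"
  have x: "x \<ge> 1" "x > Re (a + b)" unfolding x_def N_def by linarith+
  define M where "M = (\<lambda>k. norm (gauss_fps a b (complex_of_real x) $ k))"
  have xc: "complex_of_real x \<notin> \<int>\<^sub>\<le>\<^sub>0"
    using x by (intro Re_pos_imp_not_nonpos_Int) auto
  have "summable M"
    unfolding M_def using x xc by (intro summable_gauss_fps) auto
  moreover have "norm (gauss_fps a b (c + of_nat n) $ k) \<le> M k" if "n \<ge> N" for k n
  proof -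
    have "pochhammer x k \<le> norm (pochhammer (c + of_nat n) k)"
      using x that by (intro norm_pochhammer_ge) (auto simp: x_def)
    moreover have "pochhammer x k > 0" using x by (intro pochhammer_pos) auto
    ultimately show ?thesis
      unfolding M_def by (auto simp: norm_mult norm_divide pochhammer_of_real intro!: divide_left_mono mult_mono mult_pos_pos)
  qed
  moreover have "(\<lambda>n. gauss_fps a b (c + of_nat n) $ k) \<longlonglongrightarrow> (if k = 0 then 1 else 0)" for k
  proof (cases k)
    case (Suc j)
    have "filterlim (\<lambda>n. c + of_nat n) at_infinity sequentially"
      by (rule tendsto_add_filterlim_at_infinity[OF tendsto_const tendsto_of_nat])
    have "(\<lambda>n. inverse (c + of_nat n)) \<longlonglongrightarrow> 0"
      by (rule filterlim_compose[OF tendsto_inverse_0]) fact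
    moreover have "\<forall>\<^sub>F n in sequentially. norm (gauss_fps a b (c + of_nat n) $ k) \<le>
        norm (inverse (c + of_nat n)) * (norm (pochhammer a k) * norm (pochhammer b k))"
      using eventually_ge_at_top[of N]
    proof eventually_elim
      case (elim n)
      \<comment> \<open>Once the first factor \<open>c + of_nat n\<close> is split off, the rest of
        the denominator has norm at least \<open>1\<close>; the coefficient is thus bounded by a
        constant times \<open>norm (inverse (c + of_nat n))\<close>.\<close>
      have "1 \<le> norm (pochhammer (c + of_nat n + 1) j * fact k)"
      proof -
        have "(1::real) \<le> pochhammer 1 j" by (simp flip: pochhammer_fact)
        also have "\<dots> \<le> norm (pochhammer (c + of_nat n + 1) j)"
          using x elim by (intro norm_pochhammer_ge) (auto simp: x_def)
        finally have "1 * 1 \<le> norm (pochhammer (c + of_nat n + 1) j) * norm (fact k :: complex)"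
          by (intro mult_mono) (auto simp del: fact_Suc)
        thus ?thesis by (simp add: norm_mult)
      qed
      hence "norm (pochhammer a k * pochhammer b k * inverse (c + of_nat n)) /
            norm (pochhammer (c + of_nat n + 1) j * fact k) \<le>
          norm (pochhammer a k * pochhammer b k * inverse (c + of_nat n)) / 1"
        by (intro divide_left_mono) auto
      thus ?case
        using Suc by (simp add: pochhammer_rec[of "c + of_nat n"] norm_mult norm_divide norm_inverse divide_inverse mult_ac
          del: fact_Suc)
    qed
    ultimately have "(\<lambda>n. gauss_fps a b (c + of_nat n) $ k) \<longlonglongrightarrow> 0"
      by (rule tendsto_0_le)
    thus ?thesis using Suc by simp
  qed simp
  ultimately have "(\<lambda>n. \<Sum>k. gauss_fps a b (c + of_nat n) $ k) \<longlonglongrightarrow> (\<Sum>k. if k = 0 then 1 else 0)"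
    using tannerys_theorem[where F = sequentially and a = "\<lambda>k n. gauss_fps a b (c + of_nat n) $ k" and M = M
      and b = "\<lambda>k. if k = 0 then 1 else 0"]
    by (auto simp: eventually_prod_sequentially simp del: gauss_fps_nth)
  also have "(\<Sum>k. if k = 0 then 1 else 0 :: complex) = 1"
    using suminf_finite[of "{0::nat}" "\<lambda>k. if k = 0 then 1 else 0 :: complex"] by simp
  finally show ?thesis .
qed

text \<open>Lets \<open>n\<close> tend to infinity in \<open>gauss_series_shift\<close>. Working
  with \<open>rGamma\<close> covers the poles of \<open>Gamma (c - a)\<close> and
  \<open>Gamma (c - b)\<close>: there the sum is zero, and so is the quotient by the convention for
  division by zero.\<close>

theorem gauss_summation:
  fixes a b c :: complex
  assumes "c \<notin> \<int>\<^sub>\<le>\<^sub>0" "Re (c - a - b) > 0"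
  shows "(\<Sum>k. gauss_fps a b c $ k) = Gamma c * Gamma (c - a - b) / (Gamma (c - a) * Gamma (c - b))"
proof -
  let ?S = "\<Sum>k. gauss_fps a b c $ k"
  have eq: "rGamma_series (c - a) n * rGamma_series (c - b) n * (\<Sum>k. gauss_fps a b (c + of_nat (Suc n)) $ k) =
      rGamma_series c n * rGamma_series (c - a - b) n * ?S" for n
  proof -
    define L where "L = complex_of_real (ln (real n))"
    have "exp ((c - a) * L) * exp ((c - b) * L) = exp (c * L) * exp ((c - a - b) * L)"
      by (simp add: algebra_simps flip: exp_add)
    moreover have "rGamma_series (c - a) n * rGamma_series (c - b) n * (\<Sum>k. gauss_fps a b (c + of_nat (Suc n)) $ k) =
        (pochhammer (c - a) (Suc n) * pochhammer (c - b) (Suc n) * (\<Sum>k. gauss_fps a b (c + of_nat (Suc n)) $ k)) /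
        ((fact n)\<^sup>2 * (exp ((c - a) * L) * exp ((c - b) * L)))"
      by (simp add: rGamma_series_def L_def power2_eq_square mult_ac del: gauss_fps_nth)
    moreover have "rGamma_series c n * rGamma_series (c - a - b) n * ?S =
        (pochhammer c (Suc n) * pochhammer (c - a - b) (Suc n) * ?S) /
        ((fact n)\<^sup>2 * (exp (c * L) * exp ((c - a - b) * L)))"
      by (simp add: rGamma_series_def L_def power2_eq_square mult_ac del: gauss_fps_nth)
    ultimately show ?thesis
      using gauss_series_shift[OF assms, of "Suc n"] by simp
  qed
  have "(\<lambda>n. rGamma_series (c - a) n * rGamma_series (c - b) n * (\<Sum>k. gauss_fps a b (c + of_nat (Suc n)) $ k))
      \<longlonglongrightarrow> rGamma (c - a) * rGamma (c - b) * 1"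
    by (intro tendsto_intros filterlim_compose[OF gauss_series_tendsto_1 filterlim_Suc])
  moreover have "(\<lambda>n. rGamma_series c n * rGamma_series (c - a - b) n * ?S)
      \<longlonglongrightarrow> rGamma c * rGamma (c - a - b) * ?S"
    by (intro tendsto_intros)
  ultimately have "rGamma c * rGamma (c - a - b) * ?S = rGamma (c - a) * rGamma (c - b)"
    unfolding eq by (auto dest: LIMSEQ_unique simp del: gauss_fps_nth)
  moreover have "rGamma c \<noteq> 0" "rGamma (c - a - b) \<noteq> 0"
    using assms Re_pos_imp_not_nonpos_Int by (auto simp: rGamma_eq_zero_iff)
  ultimately show ?thesis
    unfolding Gamma_def by (simp add: field_simps del: gauss_fps_nth)
qed

subsection \<open>Transfer to hypergeometric series at one\<close>

text \<open>Splits a decay in \<open>k + j\<close> into separate decays in \<open>k\<close> and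
  \<open>j\<close>, so that the majorant of a double series becomes a product.\<close>

lemma powr_diag_le:
  fixes k j :: nat and p q :: real
  assumes "p \<ge> 0" "q \<ge> 0"
  shows "(real (k + j) + 1) powr (- (p + q)) \<le> (real k + 1) powr (-p) * (real j + 1) powr (-q)"
proof -
  have "(real (k + j) + 1) powr (- (p + q)) =
      (real (k + j) + 1) powr (-p) * (real (k + j) + 1) powr (-q)"
    by (simp flip: powr_add)
  also have "\<dots> \<le> (real k + 1) powr (-p) * (real j + 1) powr (-q)"
    using assms by (intro mult_mono powr_mono2') auto
  finally show ?thesis .
qed

lemma summable_on_product_family:
  fixes f g :: "nat \<Rightarrow> real"
  assumes "summable (\<lambda>n. norm (f n))" "summable (\<lambda>n. norm (g n))"
  shows "(\<lambda>(k, j). f k * g j) summable_on UNIV \<times> UNIV"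
proof -
  have "(\<lambda>n. norm (f n)) summable_on UNIV" "(\<lambda>n. norm (g n)) summable_on UNIV"
    using norm_summable_imp_summable_on[of "\<lambda>n. norm (f n)"]
      norm_summable_imp_summable_on[of "\<lambda>n. norm (g n)"] assms by simp_all
  hence "(\<lambda>x. norm (case x of (k, j) \<Rightarrow> f k * g j)) summable_on UNIV \<times> UNIV"
    by (subst Infinite_Sum.abs_summable_on_Sigma_iff)
       (auto simp: abs_mult infsum_cmult_right' intro!: summable_on_cmult_right summable_on_cmult_left)
  thus ?thesis by (rule Infinite_Sum.abs_summable_summable)
qed

lemma suminf_eq_infsum_UNIV:
  fixes f :: "nat \<Rightarrow> complex"
  assumes "f summable_on UNIV"
  shows "suminf f = infsum f UNIV"
  using assms by (metis has_sum_infsum has_sum_imp_sums sums_unique)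

text \<open>Splitting the symbols at \<open>k\<close> leaves a Gauss series with parameters
  \<open>d + k\<close>, \<open>-D\<close>, \<open>e + k\<close>; the quantity that decides its
  convergence, \<open>e - d + D\<close>, does not depend on \<open>k\<close>.\<close>

lemma inner_gauss_sum:
  fixes d D e :: complex
  assumes "e \<notin> \<int>\<^sub>\<le>\<^sub>0" "e + D \<notin> \<int>\<^sub>\<le>\<^sub>0" "Re (e - d + D) > 0"
  shows "(\<lambda>j. pochhammer d (k + j) / pochhammer e (k + j) * (pochhammer (-D) j / fact j)) sums
    (Gamma e * Gamma (e - d + D) / (Gamma (e - d) * Gamma (e + D)) *
    (pochhammer d k / pochhammer (e + D) k))"
proof -
  let ?g = "gauss_fps (d + of_nat k) (-D) (e + of_nat k)"
  have "(\<lambda>j. ?g $ j) sums (\<Sum>j. ?g $ j)"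
    using assms nonpos_Ints_shift(3)[OF assms(1)]
    by (intro summable_sums summable_norm_cancel[OF summable_gauss_fps]) auto
  also have "(\<Sum>j. ?g $ j) =
      Gamma (e + of_nat k) * Gamma (e - d + D) / (Gamma (e - d) * Gamma (e + D + of_nat k))"
    using assms gauss_summation[OF nonpos_Ints_shift(3)[OF assms(1), of k], of "d + of_nat k" "-D"]
    by (simp add: algebra_simps del: gauss_fps_nth)
  also have "Gamma (e + of_nat k) = pochhammer e k * Gamma e"
    using assms by (simp add: pochhammer_Gamma Gamma_eq_zero_iff)
  also have "Gamma (e + D + of_nat k) = pochhammer (e + D) k * Gamma (e + D)"
    using assms by (simp add: pochhammer_Gamma Gamma_eq_zero_iff)
  finally have "(\<lambda>j. pochhammer d k / pochhammer e k * ?g $ j) sums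
      (pochhammer d k / pochhammer e k * (pochhammer e k * Gamma e * Gamma (e - d + D) /
        (Gamma (e - d) * (pochhammer (e + D) k * Gamma (e + D)))))"
    by (rule sums_mult)
  thus ?thesis
    using nonpos_Ints_shift(5)[OF assms(1)] by (simp add: pochhammer_product' mult_ac)
qed

text \<open>Summed over \<open>j\<close> first, the family \<open>f\<close> gives the right-hand
  side by Gauss's theorem; summed along the antidiagonals \<open>k + j = n\<close> it gives the
  left-hand side.\<close>

lemma thomae_transfer_nonpos:
  fixes A B :: "complex fps" and d e D :: complex
  assumes A: "A = binom_fps (-D) * B"
    and B: "growth_le (\<lambda>n. B $ n) (Re D - 1)"
    and e: "e \<notin> \<int>\<^sub>\<le>\<^sub>0" "e + D \<notin> \<int>\<^sub>\<le>\<^sub>0"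
    and Re: "Re D \<le> 0" "Re (e - d) > 0" "Re (e - d + D) > 0"
  shows "(\<Sum>n. A $ n * (pochhammer d n / pochhammer e n)) =
    Gamma e * Gamma (e - d + D) / (Gamma (e - d) * Gamma (e + D)) *
    (\<Sum>n. B $ n * (pochhammer d n / pochhammer (e + D) n))"
proof -
  \<comment> \<open>\<open>\<tau>\<close> distributes the decay \<open>(k + j + 1) powr (-\<epsilon>)\<close> over the two summation indices.\<close>
  define \<tau> where "\<tau> = (Re (e - d) - Re D) / 2"
  define \<epsilon> where "\<epsilon> = Re (e - d)"
  \<comment> \<open>\<open>\<tau>\<close> is the midpoint of \<open>- Re D\<close> and
    \<open>\<epsilon>\<close>, and \<open>Re (e - d + D) > 0\<close> says
    \<open>- Re D < \<epsilon>\<close>. With \<open>Re D \<le> 0\<close>, both shares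
    \<open>\<tau>\<close> and \<open>\<epsilon> - \<tau>\<close> are nonnegative and both exponents
    fall below \<open>-1\<close>.\<close>
  have \<tau>: "\<tau> \<ge> 0" "\<epsilon> - \<tau> \<ge> 0" "Re D - 1 - (\<epsilon> - \<tau>) < -1" "Re (-D) - 1 - \<tau> < -1"
    using Re by (simp_all add: \<tau>_def \<epsilon>_def field_simps)
  define f where "f = (\<lambda>k j. B $ k * (pochhammer d (k + j) / pochhammer e (k + j) *
      (pochhammer (-D) j / fact j)))"
  define C where "C = Gamma e * Gamma (e - d + D) / (Gamma (e - d) * Gamma (e + D))"
  obtain K1 where K1: "K1 \<ge> 0" "\<And>n. norm (B $ n) \<le> K1 * (real n + 1) powr (Re D - 1)"
    using B by (auto elim!: growth_leE)
  obtain K2 where K2: "K2 \<ge> 0" "\<And>n. norm (pochhammer d n / pochhammer e n) \<le> K2 * (real n + 1) powr (-\<epsilon>)"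
    using growth_pochhammer_quotient[OF e(1), of d] by (auto elim!: growth_leE simp: \<epsilon>_def)
  obtain K3 where K3: "K3 \<ge> 0" "\<And>n. norm (pochhammer (-D) n / fact n) \<le> K3 * (real n + 1) powr (Re (-D) - 1)"
    using growth_pochhammer by (metis growth_leE)
  define g h where "g = (\<lambda>k. K1 * K2 * K3 * (real k + 1) powr (Re D - 1 - (\<epsilon> - \<tau>)))"
    and "h = (\<lambda>j. (real j + 1) powr (Re (-D) - 1 - \<tau>))"
  have bound: "norm (f k j) \<le> g k * h j" for k j
  proof -
    have "norm (pochhammer d (k + j) / pochhammer e (k + j)) \<le> K2 * (real (k + j) + 1) powr (-\<epsilon>)"
      by (rule K2)
    also have "\<dots> \<le> K2 * ((real k + 1) powr (-(\<epsilon> - \<tau>)) * (real j + 1) powr (-\<tau>))"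
      using powr_diag_le[OF \<tau>(2,1), of k j] K2(1) by (intro mult_left_mono) auto
    finally have "norm (f k j) \<le> (K1 * (real k + 1) powr (Re D - 1)) *
        ((K2 * ((real k + 1) powr (-(\<epsilon> - \<tau>)) * (real j + 1) powr (-\<tau>))) *
        (K3 * (real j + 1) powr (Re (-D) - 1)))"
      unfolding f_def norm_mult using K1 K2(1) K3 by (intro mult_mono) auto
    also have "\<dots> = g k * h j"
    proof -
      have "(real k + 1) powr (Re D - 1 - (\<epsilon> - \<tau>)) =
          (real k + 1) powr (Re D - 1) * (real k + 1) powr (-(\<epsilon> - \<tau>))"
        "(real j + 1) powr (Re (-D) - 1 - \<tau>) =
          (real j + 1) powr (Re (-D) - 1) * (real j + 1) powr (-\<tau>)"
        unfolding powr_add [symmetric] by (intro arg_cong2[of _ _ _ _ "(powr)"]; simp)+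
      thus ?thesis
        unfolding g_def h_def by (simp only: mult_ac)
    qed
    finally show ?thesis .
  qed
  have "growth_le g (Re D - 1 - (\<epsilon> - \<tau>))"
    unfolding growth_le_def g_def using K1(1) K2(1) K3(1)
    by (intro exI[of _ "K1 * K2 * K3"]) (simp add: abs_mult)
  moreover have "growth_le h (Re (-D) - 1 - \<tau>)"
    unfolding growth_le_def h_def by (intro exI[of _ 1]) simp
  ultimately have "(\<lambda>(k, j). g k * h j) summable_on UNIV \<times> UNIV"
    using \<tau> by (intro summable_on_product_family growth_le_imp_summable) auto
  hence "(\<lambda>x. norm (case x of (k, j) \<Rightarrow> f k j)) summable_on UNIV \<times> UNIV"
    by (rule Infinite_Sum.abs_summable_on_comparison_test') (use bound in auto)
  hence sum: "(\<lambda>(k, j). f k j) summable_on UNIV \<times> UNIV"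
    by (rule Infinite_Sum.abs_summable_summable)
  have inner: "infsum (f k) UNIV = C * (B $ k * (pochhammer d k / pochhammer (e + D) k))" for k
  proof -
    have "(\<lambda>j. f k j) summable_on UNIV"
      using sum summable_on_SigmaD1[of "\<lambda>k j. f k j" UNIV "\<lambda>_. UNIV" k] by simp
    moreover have "f k sums (B $ k * (C * (pochhammer d k / pochhammer (e + D) k)))"
      unfolding f_def C_def by (intro sums_mult inner_gauss_sum e Re)
    ultimately show ?thesis
      by (metis suminf_eq_infsum_UNIV sums_unique mult.left_commute)
  qed
  have outer: "(\<Sum>k\<le>n. f k (n - k)) = A $ n * (pochhammer d n / pochhammer e n)" for n
    unfolding A mult.commute[of "binom_fps (-D)"] fps_mult_nth f_def atLeast0AtMost sum_distrib_right
    by (intro sum.cong) (auto simp: mult_ac)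
  \<comment> \<open>The bijection from \<open>(k, j)\<close> to \<open>(k + j, k)\<close> regroups
    the family by \<open>n = k + j\<close>.\<close>
  have sum': "(\<lambda>(n, k). f k (n - k)) summable_on (SIGMA n:UNIV. {..n})"
    using sum by (subst summable_on_reindex_bij_witness[of _ "\<lambda>(k, j). (k + j, k)" "\<lambda>(n, k). (k, n - k)"
      "UNIV \<times> UNIV" "\<lambda>(k, j). f k j"]) auto
  have sum_B: "(\<lambda>k. B $ k * (pochhammer d k / pochhammer (e + D) k)) summable_on UNIV"
  proof (intro norm_summable_imp_summable_on growth_le_imp_summable)
    show "growth_le (\<lambda>k. B $ k * (pochhammer d k / pochhammer (e + D) k)) ((Re D - 1) + (Re d - Re (e + D)))"
      by (intro growth_le_mult B growth_pochhammer_quotient e)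
  qed (use Re in simp)
  have "infsum (\<lambda>(n, k). f k (n - k)) (SIGMA n:UNIV. {..n}) = infsum (\<lambda>(k, j). f k j) (UNIV \<times> UNIV)"
    by (intro infsum_reindex_bij_witness[of _ "\<lambda>(k, j). (k + j, k)" "\<lambda>(n, k). (k, n - k)"]) auto
  moreover have "infsum (\<lambda>(k, j). f k j) (UNIV \<times> UNIV) = (\<Sum>\<^sub>\<infinity>k. C * (B $ k * (pochhammer d k / pochhammer (e + D) k)))"
    using infsum_Sigma'_banach[OF sum] by (simp add: inner)
  moreover have "infsum (\<lambda>(n, k). f k (n - k)) (SIGMA n:UNIV. {..n}) =
      (\<Sum>\<^sub>\<infinity>n. A $ n * (pochhammer d n / pochhammer e n))"
    using infsum_Sigma'_banach[OF sum'] by (simp add: outer)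
  moreover have "(\<lambda>n. A $ n * (pochhammer d n / pochhammer e n)) summable_on UNIV"
    using summable_on_Sigma_banach[OF sum'] by (simp add: outer)
  ultimately have "(\<Sum>n. A $ n * (pochhammer d n / pochhammer e n)) =
      (\<Sum>\<^sub>\<infinity>k. C * (B $ k * (pochhammer d k / pochhammer (e + D) k)))"
    by (simp add: suminf_eq_infsum_UNIV)
  also have "\<dots> = C * (\<Sum>\<^sub>\<infinity>k. B $ k * (pochhammer d k / pochhammer (e + D) k))"
    by (rule infsum_cmult_right')
  also have "(\<Sum>\<^sub>\<infinity>k. B $ k * (pochhammer d k / pochhammer (e + D) k)) =
      (\<Sum>k. B $ k * (pochhammer d k / pochhammer (e + D) k))"
    using suminf_eq_infsum_UNIV[OF sum_B] ..
  finally show ?thesis unfolding C_def .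
qed

text \<open>
  If \<open>Re D > 0\<close>, the double series need not converge absolutely; but then exchanging
  \<open>(A, D, e)\<close> with \<open>(B, -D, e + D)\<close> leads back to the previous case.
\<close>

theorem thomae_transfer:
  fixes A B :: "complex fps" and d e D :: complex
  assumes AB: "binom_fps D * A = B"
    and A: "growth_le (\<lambda>n. A $ n) (- Re D - 1)"
    and B: "growth_le (\<lambda>n. B $ n) (Re D - 1)"
    and e: "e \<notin> \<int>\<^sub>\<le>\<^sub>0" "e + D \<notin> \<int>\<^sub>\<le>\<^sub>0"
    and Re: "Re (e - d) > 0" "Re (e - d + D) > 0"
  shows "(\<Sum>n. A $ n * (pochhammer d n / pochhammer e n)) =
    Gamma e * Gamma (e - d + D) / (Gamma (e - d) * Gamma (e + D)) *
    (\<Sum>n. B $ n * (pochhammer d n / pochhammer (e + D) n))"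
proof (cases "Re D \<le> 0")
  case True
  have "A = binom_fps (-D) * B"
    unfolding AB[symmetric] mult.assoc[symmetric] binom_fps_mult by simp
  from thomae_transfer_nonpos[OF this B e True Re] show ?thesis .
next
  case False
  have "(\<Sum>n. B $ n * (pochhammer d n / pochhammer (e + D) n)) =
    Gamma (e + D) * Gamma (e + D - d + (-D)) / (Gamma (e + D - d) * Gamma (e + D + (-D))) *
    (\<Sum>n. A $ n * (pochhammer d n / pochhammer (e + D + (-D)) n))"
    by (rule thomae_transfer_nonpos) (use assms False in auto)
  moreover have "Gamma (e + D) \<noteq> 0" "Gamma e \<noteq> 0" "Gamma (e - d) \<noteq> 0" "Gamma (e - d + D) \<noteq> 0"
    using e Re Re_pos_imp_not_nonpos_Int by (auto simp: Gamma_eq_zero_iff)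
  moreover have "e + D - d = e - d + D" by simp
  ultimately show ?thesis by (simp add: field_simps)
qed

section \<open>Polynomial factors: growth and zeros\<close>

lemma growth_poly:
  fixes p :: "complex poly"
  assumes "degree p \<le> m"
  shows "growth_le (\<lambda>n. poly p (of_nat n)) (real m)"
proof -
  have "norm (poly p (of_nat n)) \<le> (\<Sum>i\<le>degree p. norm (coeff p i)) * (real n + 1) powr real m" for n
  proof -
    have "norm (poly p (of_nat n)) \<le> (\<Sum>i\<le>degree p. norm (coeff p i * of_nat n ^ i))"
      unfolding poly_altdef by (rule norm_sum)
    also have "\<dots> \<le> (\<Sum>i\<le>degree p. norm (coeff p i) * (real n + 1) ^ m)"
    proof (intro sum_mono)
      fix i assume "i \<in> {..degree p}"
      hence "real n ^ i \<le> (real n + 1) ^ i" "(real n + 1) ^ i \<le> (real n + 1) ^ m"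
        using assms by (auto intro: power_mono power_increasing)
      thus "norm (coeff p i * of_nat n ^ i) \<le> norm (coeff p i) * (real n + 1) ^ m"
        by (auto simp: norm_mult norm_power intro!: mult_left_mono)
    qed
    finally show ?thesis by (simp add: sum_distrib_right powr_realpow)
  qed
  thus ?thesis unfolding growth_le_def by blast
qed

lemma degree_Qhat_poly: "degree (Qhat_poly a b c fs ms) \<le> sum_list ms"
proof -
  define m where "m = sum_list ms"
  have G: "degree (G_poly m k a b c) \<le> m - k" for k
    unfolding G_poly_def
    by (intro degree_sum_le order.trans[OF degree_smult_le] order.trans[OF degree_pochhammer_linear]) auto
  have "degree (pochhammer [:0, 1:] k * G_poly m k a b c) \<le> m" if "k \<le> m" for k
    using degree_mult_le[of "pochhammer [:0, 1:] k" "G_poly m k a b c"] G[of k]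
      degree_pochhammer_linear[of 0 k] that by linarith
  thus ?thesis
    unfolding Qhat_poly_def Let_def m_def[symmetric]
    by (intro degree_sum_le order.trans[OF degree_smult_le]) auto
qed

text \<open>The value \<open>1\<close> at zero makes all zeros nonzero; comparing the factorizations
  at \<open>-x\<close> and at \<open>0\<close> cancels the leading coefficient. This is the
  convention for the parameter pairs, whatever the degree of \<open>p\<close>.\<close>

lemma poly_eq_prod_list_proots:
  fixes p :: "complex poly"
  assumes "poly p 0 = 1" "mset hs = proots p"
  shows "(\<Prod>h\<leftarrow>hs. 1 + x / h) = poly p (-x)"
proof -
  have p: "p = smult (lead_coeff p) (\<Prod>h\<in>#proots p. [:-h, 1:])"
    by (simp add: complex_poly_decompose_multiset)
  have "p \<noteq> 0" using assms(1) by auto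
  hence nz: "h \<noteq> 0" if "h \<in> set hs" for h
    using assms that by (metis set_count_proots set_mset_mset mem_Collect_eq zero_neq_one)
  have prod: "(\<Prod>h\<in>#proots p. [:-h, 1:]) = (\<Prod>h\<leftarrow>hs. [:-h, 1:])"
    unfolding assms(2)[symmetric] by (simp flip: prod_mset_prod_list)
  have eval: "poly (\<Prod>h\<leftarrow>hs. [:-h, 1:]) y = (\<Prod>h\<leftarrow>hs. y - h)" for y
    by (induction hs) (auto simp: algebra_simps)
  have at: "poly p y = lead_coeff p * (\<Prod>h\<leftarrow>hs. y - h)" for y
    by (subst p) (simp add: prod eval)
  have "(\<Prod>h\<leftarrow>hs. -x - h) = (\<Prod>h\<leftarrow>hs. 0 - h) * (\<Prod>h\<leftarrow>hs. 1 + x / h)"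
    using nz by (induction hs) (auto simp: field_simps)
  hence "poly p (-x) = poly p 0 * (\<Prod>h\<leftarrow>hs. 1 + x / h)"
    unfolding at by (simp only: mult.assoc)
  thus ?thesis using assms(1) by simp
qed

lemma growth_sum_C_coeff:
  assumes "length fs = length ms"
  shows "growth_le (\<lambda>n. \<Sum>l\<le>sum_list ms. C_coeff fs ms l * (fact l * of_nat (n choose l)))
    (real (sum_list ms))"
proof -
  \<comment> \<open>The product of the \<open>pochhammer (f + x) n\<close> divided by
    \<open>Lambda_prod\<close>, rebuilt from its coefficients so that the degree bound is
    immediate.\<close>
  define p where "p = smult (1 / Lambda_prod fs ms) (\<Sum>j\<le>sum_list ms. monom (sigma_coeff fs ms j) j)"
  have "degree p \<le> sum_list ms"
    unfolding p_def by (intro order.trans[OF degree_smult_le] degree_sum_le order.trans[OF degree_monom_le]) auto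
  moreover have "(\<Sum>l\<le>sum_list ms. C_coeff fs ms l * (fact l * of_nat (n choose l))) = poly p (of_nat n)" for n
    unfolding sum_C_coeff_falling[OF assms] sigma_coeff_identity[OF assms]
    by (simp add: p_def poly_sum poly_monom atLeast0AtMost)
  ultimately show ?thesis
    using growth_poly[of p "sum_list ms"] by simp
qed

lemma growth_Qhat: "growth_le (\<lambda>n. Qhat a b c fs ms (- of_nat n)) (real (sum_list ms))"
proof -
  have "degree (pcompose (Qhat_poly a b c fs ms) [:0, -1:]) \<le> sum_list ms"
    using degree_Qhat_poly[of a b c fs ms] by (simp add: degree_pcompose)
  from growth_poly[OF this] show ?thesis
    by (simp add: poly_pcompose poly_Qhat_poly)
qed

theorem theorem2:
  fixes r m :: nat and ms :: "nat list" and fs \<eta> :: "complex list"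
    and a b c d e s :: complex
  assumes "length ms = r" and "length fs = r"
    and "\<forall>n\<in>set ms. n > 0"
    and "m = sum_list ms"
    and "s = c + e - a - b - d - of_nat m"
    and "c \<notin> \<int>\<^sub>\<le>\<^sub>0" and "e \<notin> \<int>\<^sub>\<le>\<^sub>0" and "s + d \<notin> \<int>\<^sub>\<le>\<^sub>0"
    and "\<forall>f\<in>set fs. f \<notin> \<int>\<^sub>\<le>\<^sub>0"
    and "pochhammer (c - a - of_nat m) m \<noteq> 0"
    and "pochhammer (c - b - of_nat m) m \<noteq> 0"
    and "Re (e - d) > 0" and "Re s > 0"
    and "mset \<eta> = proots (Qhat_poly a b c fs ms)"
  shows "summable (hypergeom_term
            ([a, b, d] @ map2 (\<lambda>f n. f + of_nat n) fs ms) ([c, e] @ fs) 1) \<and>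
         summable (hypergeom_pairs_term
            [c - a - of_nat m, c - b - of_nat m, d] [c, s + d] \<eta> 1) \<and>
         (\<Sum>k. hypergeom_term
            ([a, b, d] @ map2 (\<lambda>f n. f + of_nat n) fs ms) ([c, e] @ fs) 1 k) =
         Gamma e * Gamma s / (Gamma (e - d) * Gamma (s + d)) *
         (\<Sum>k. hypergeom_pairs_term
            [c - a - of_nat m, c - b - of_nat m, d] [c, s + d] \<eta> 1 k)"
proof -
  define \<alpha> \<beta> D where "\<alpha> = c - a - of_nat m" and "\<beta> = c - b - of_nat m" and "D = c - a - b - of_nat m"
  define A where "A = Abs_fps (\<lambda>n. hypergeom_term [a, b] [c] 1 n *
    (\<Sum>l\<le>m. C_coeff fs ms l * (fact l * of_nat (n choose l))))"
  define B where "B = binom_fps D * A"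
  have len: "length fs = length ms" using assms(1,2) by simp
  \<comment> \<open>The shift by \<open>D\<close> moves \<open>e\<close> to \<open>s + d\<close> and
    \<open>e - d\<close> to \<open>s\<close>, which matches the parameters of the claim with those
    of \<open>thomae_transfer\<close>.\<close>
  have sd: "e + D = s + d" "e - d + D = s" by (simp_all add: D_def assms(5))
  have Re_s: "Re s = Re e - Re d + Re D"
    using arg_cong[OF sd(2), of Re] by simp
  have gauss: "hypergeom_term [x, y] [c] 1 n = gauss_fps x y c $ n" for x y n
    by (simp add: hypergeom_term_altdef)
  have B_nth: "B $ n = hypergeom_term [\<alpha>, \<beta>] [c] 1 n * Qhat a b c fs ms (- of_nat n)" for n
    using miller_paris_fps[of c a ms b fs n] assms(6,10,11)
    unfolding B_def A_def D_def \<alpha>_def \<beta>_def assms(4) by simp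

  \<comment> \<open>This is the constant term of \<open>A\<close>, hence of \<open>B\<close>; the
    coefficient formula for \<open>B\<close> at \<open>n = 0\<close> then gives \<open>Qhat\<close>
    the value \<open>1\<close> at zero.\<close>
  have "(\<Sum>l\<le>m. C_coeff fs ms l * (fact l * of_nat (0 choose l))) = 1"
    using sum_C_coeff_falling[OF len, of 0] Lambda_prod_nonzero[OF len assms(9)]
    by (simp add: assms(4) Lambda_prod_def)
  hence "Qhat a b c fs ms 0 = 1"
    using B_nth[of 0] by (simp add: B_def A_def hypergeom_term_altdef fps_mult_nth)
  hence zeros: "(\<Prod>h\<leftarrow>\<eta>. 1 + of_nat n / h) = Qhat a b c fs ms (- of_nat n)" for n
    using poly_eq_prod_list_proots[of "Qhat_poly a b c fs ms" \<eta> "of_nat n"] assms(14)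
    by (simp add: poly_Qhat_poly)

  have lhs: "hypergeom_term ([a, b, d] @ map2 (\<lambda>f n. f + of_nat n) fs ms) ([c, e] @ fs) 1 =
      (\<lambda>n. A $ n * (pochhammer d n / pochhammer e n))"
    unfolding hypergeom_term_shifted_pairs[OF len assms(9)] assms(4)[symmetric] A_def
    by (simp add: fun_eq_iff hypergeom_term_altdef mult_ac)
  have rhs: "hypergeom_pairs_term [\<alpha>, \<beta>, d] [c, s + d] \<eta> 1 =
      (\<lambda>n. B $ n * (pochhammer d n / pochhammer (s + d) n))"
    unfolding hypergeom_pairs_term_def zeros B_nth by (simp add: fun_eq_iff hypergeom_term_altdef mult_ac)

  have growth_A: "growth_le (\<lambda>n. A $ n) (- Re D - 1)"
    using growth_le_mult[OF growth_gauss_fps[OF assms(6), of a b] growth_sum_C_coeff[OF len]]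
    by (simp add: A_def gauss D_def assms(4) algebra_simps)
  have growth_B: "growth_le (\<lambda>n. B $ n) (Re D - 1)"
    using growth_le_mult[OF growth_gauss_fps[OF assms(6), of \<alpha> \<beta>] growth_Qhat[of a b c fs ms]]
    by (simp add: B_nth gauss D_def \<alpha>_def \<beta>_def assms(4) algebra_simps)
  \<comment> \<open>The growth exponents of the two series are \<open>- Re s - 1\<close> and
    \<open>- Re (e - d) - 1\<close>, so each of the two positivity assumptions makes one side
    converge.\<close>
  have "summable (\<lambda>n. A $ n * (pochhammer d n / pochhammer e n))"
    by (rule summable_norm_cancel, rule growth_le_imp_summable,
        rule growth_le_mult[OF growth_A growth_pochhammer_quotient[OF assms(7)]])
       (use assms(13) Re_s in simp)
  moreover have "summable (\<lambda>n. B $ n * (pochhammer d n / pochhammer (s + d) n))"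
    by (rule summable_norm_cancel, rule growth_le_imp_summable,
        rule growth_le_mult[OF growth_B growth_pochhammer_quotient[OF assms(8)]])
       (use assms(12) Re_s in simp)
  moreover have "(\<Sum>n. A $ n * (pochhammer d n / pochhammer e n)) =
      Gamma e * Gamma s / (Gamma (e - d) * Gamma (s + d)) *
      (\<Sum>n. B $ n * (pochhammer d n / pochhammer (s + d) n))"
    using thomae_transfer[OF B_def[symmetric] growth_A growth_B assms(7) _ assms(12)] assms(8,13)
    unfolding sd by blast
  ultimately show ?thesis
    unfolding lhs rhs[unfolded \<alpha>_def \<beta>_def] by blast
qed

end
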